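(* Let $t>0$, $x\in\mathbb R$, $0<\underline c<\overline c<\infty$, and let $X(\omega)=\{u_c(x,t,\omega):\underline c\le c\le\overline c\}$, where $u_c(x,t)=\langle\dot W,\tfrac1{2c}\chi_{(x,t,c)}\rangle$ is the solution of the one-dimensional stochastic wave equation with propagation speed $c$. Let $B=(\underline b,\overline b)$ be an open interval and put $\underline r=1/\overline c$, $\overline r=1/\underline c$, $g(y)=\frac1{\sqrt{2\pi\underline r}}e^{-y^2/(2\underline r)}$. Then the lower probability $\underline P(B)=P(X\subset B)$ is given by $$\underline P(B)=\int_{\frac2t\underline b}^{\frac2t\overline b}\Big(1-F_{\tau(\frac2t\underline b-y,\,\frac2t\overline b-y)}(\overline r-\underline r)\Big)g(y)\,dy,$$ where, for $a<0<b$, $F_{\tau(a,b)}(s)=P(\tau(a,b)\le s)$ is the distribution function of the first exit time $\tau(a,b)=\min\{s:w_s\notin(a,b)\}$ of a standard Brownian motion $(w_s)_{s\ge0}$ starting at $0$.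
   Context: White noise: here $d=1$, $D=\mathbb R\times[0,\infty)$, and $\mathcal S(D)$ is the space of restrictions to $D$ of Schwartz functions on $\mathbb R^2$. The white noise probability space $(\Omega,\Sigma,P)$ is the completion of $\mathcal S'(D)$ with the weak-$\ast$ Borel $\sigma$-algebra and the unique probability measure satisfying $\int e^{i\langle\omega,\varphi\rangle}dP(\omega)=e^{-\frac12\|\varphi\|^2_{L^2(D)}}$ for all $\varphi\in\mathcal S(D)$. White noise is $\langle\dot W(\omega),\varphi\rangle=\langle\omega,\varphi|_D\rangle$; it is Gaussian with $\mathrm E\langle\dot W,\varphi\rangle=0$ and $\mathrm E(\langle\dot W,\varphi\rangle)^2=\|\varphi\|_{L^2(D)}^2$ (Itô isometry), and by this isometry $\langle\dot W,\cdot\rangle$ is extended to functions in $L^2(\mathbb R^2)$. For $(x,t)\in\mathbb R\times(0,\infty)$ and $c>0$, $\chi_{(x,t,c)}$ is the indicator function of the backward triangle with vertex $(x,t)$, i.e. the region $0\le s\le t$, $|y-x|\le c(t-s)$ in the $(y,s)$-plane. The random field solution of $(\partial_t^2-c^2\partial_x^2)u_c=\dot W$ with support in $\mathbb R\times[0,\infty)$ is $u_c(x,t)=\langle\dot W,\tfrac1{2c}\chi_{(x,t,c)}\rangle$. A version of $u_c(x,t)$ is used for which $c\mapsto u_c(x,t,\omega)$ is continuous on $(0,\infty)$ for almost all $\omega$. Known formula for the exit time distribution: $F_{\tau(a,b)}(s)=\int_0^s \mathrm{cc}_\sigma\big(\tfrac{b+a}2,\tfrac{b-a}2\big)d\sigma$,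 where for $x<y$, $\mathrm{cc}_\sigma(x,y)=\mathcal L^{-1}_{\gamma\to\sigma}\Big(\frac{\cosh(x\sqrt{2\gamma})}{\cosh(y\sqrt{2\gamma})}\Big)$ and $\mathcal L^{-1}$ is the inverse Laplace transform. *)

theory Defs
  imports "HOL-Probability.Probability"
begin

section \<open>Schwartz functions and tempered distributions on the half plane\<close>

definition pderiv_along :: "'a::euclidean_space \<Rightarrow> ('a \<Rightarrow> real) \<Rightarrow> 'a \<Rightarrow> real" where
  "pderiv_along e f p = frechet_derivative f (at p) e"

abbreviation iter_pderiv :: "'a::euclidean_space list \<Rightarrow> ('a \<Rightarrow> real) \<Rightarrow> 'a \<Rightarrow> real" where
  "iter_pderiv es f \<equiv> foldr pderiv_along es f"

text \<open>Smoothness: all iterated partial derivatives, in any order, are totally differentiable.\<close>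

definition schwartz_functions :: "('a::euclidean_space \<Rightarrow> real) set" where
  "schwartz_functions = {f. \<forall>es \<in> lists Basis.
      iter_pderiv es f differentiable_on UNIV \<and>
      (\<forall>N::nat. bounded (range (\<lambda>p. (1 + norm p) ^ N * iter_pderiv es f p)))}"

definition schwartz_norm :: "nat \<Rightarrow> ('a::euclidean_space \<Rightarrow> real) \<Rightarrow> real" where
  "schwartz_norm N f =
     (\<Sum>es \<in> {es \<in> lists Basis. length es \<le> N}. SUP p. (1 + norm p) ^ N * \<bar>iter_pderiv es f p\<bar>)"

definition half_plane :: "(real \<times> real) set" where
  "half_plane = UNIV \<times> {0..}"

definition schwartz_half_plane :: "(real \<times> real \<Rightarrow> real) set" where
  "schwartz_half_plane = (\<lambda>\<phi>. restrict \<phi> half_plane) ` schwartz_functions"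

text \<open>Elements of the dual space are functionals on \<^const>\<open>schwartz_half_plane\<close>, represented
  as extensional functions.  Continuity refers to the quotient topology of the restriction map:
  a linear functional is continuous iff its composition with the restriction map is bounded by
  one of the (increasing) norms that define the topology of the Schwartz space.\<close>

definition tempered_half_plane :: "((real \<times> real \<Rightarrow> real) \<Rightarrow> real) set" where
  "tempered_half_plane = {\<omega> \<in> extensional schwartz_half_plane.
      (\<forall>f \<in> schwartz_half_plane. \<forall>g \<in> schwartz_half_plane. \<forall>a b.
         \<omega> (\<lambda>p\<in>half_plane. a * f p + b * g p) = a * \<omega> f + b * \<omega> g) \<and>
      (\<exists>N C. \<forall>\<phi> \<in> schwartz_functions. \<bar>\<omega> (restrict \<phi> half_plane)\<bar> \<le> C * schwartz_norm N \<phi>)}"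

text \<open>The weak-star topology is the topology of pointwise convergence.\<close>

definition weak_star_topology :: "((real \<times> real \<Rightarrow> real) \<Rightarrow> real) topology" where
  "weak_star_topology =
     subtopology (product_topology (\<lambda>_. euclideanreal) schwartz_half_plane) tempered_half_plane"

definition weak_star_borel :: "((real \<times> real \<Rightarrow> real) \<Rightarrow> real) measure" where
  "weak_star_borel = sigma tempered_half_plane {U. openin weak_star_topology U}"

section \<open>White noise\<close>

definition white_noise_space :: "((real \<times> real \<Rightarrow> real) \<Rightarrow> real) measure \<Rightarrow> bool" where
  "white_noise_space P \<longleftrightarrow>
     (\<exists>P0. prob_space P0 \<and> sets P0 = sets weak_star_borel \<and>
        (\<forall>\<phi> \<in> schwartz_half_plane.
           (\<integral>\<omega>. exp (\<i> * complex_of_real (\<omega> \<phi>)) \<partial>P0) =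
             complex_of_real (exp (- (1/2) * (LINT p:half_plane|lborel. (\<phi> p)\<^sup>2)))) \<and>
        P = completion P0)"

definition white_noise :: "(real \<times> real \<Rightarrow> real) \<Rightarrow> ((real \<times> real \<Rightarrow> real) \<Rightarrow> real) \<Rightarrow> real" where
  "white_noise \<phi> \<omega> = \<omega> (restrict \<phi> half_plane)"

text \<open>\<open>X\<close> represents the pairing of white noise with the square integrable function \<open>h\<close>:
  the value at \<open>h\<close> of the extension, by the Ito isometry, of \<^const>\<open>white_noise\<close>
  from Schwartz functions to square integrable functions.  It is determined up to null sets.\<close>

definition white_noise_pairing ::
  "((real \<times> real \<Rightarrow> real) \<Rightarrow> real) measure \<Rightarrow> (real \<times> real \<Rightarrow> real)
     \<Rightarrow> (((real \<times> real \<Rightarrow> real) \<Rightarrow> real) \<Rightarrow> real) \<Rightarrow> bool" where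
  "white_noise_pairing P h X \<longleftrightarrow>
     h \<in> borel_measurable lborel \<and> integrable lborel (\<lambda>p. (h p)\<^sup>2) \<and>
     X \<in> borel_measurable P \<and>
     (\<exists>\<phi> :: nat \<Rightarrow> real \<times> real \<Rightarrow> real. (\<forall>n. \<phi> n \<in> schwartz_functions) \<and>
        (\<lambda>n. \<integral>\<^sup>+p\<in>half_plane. ennreal ((\<phi> n p - h p)\<^sup>2) \<partial>lborel) \<longlonglongrightarrow> 0 \<and>
        (\<lambda>n. \<integral>\<^sup>+\<omega>. ennreal ((white_noise (\<phi> n) \<omega> - X \<omega>)\<^sup>2) \<partial>P) \<longlonglongrightarrow> 0)"

section \<open>The stochastic wave equation\<close>

definition backward_triangle :: "real \<Rightarrow> real \<Rightarrow> real \<Rightarrow> (real \<times> real) set" where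
  "backward_triangle x t c = {(y, s). 0 \<le> s \<and> s \<le> t \<and> \<bar>y - x\<bar> \<le> c * (t - s)}"

definition random_field_solution ::
  "((real \<times> real \<Rightarrow> real) \<Rightarrow> real) measure \<Rightarrow> real
     \<Rightarrow> (real \<Rightarrow> real \<Rightarrow> ((real \<times> real \<Rightarrow> real) \<Rightarrow> real) \<Rightarrow> real) \<Rightarrow> bool" where
  "random_field_solution P c v \<longleftrightarrow>
     (\<forall>x. \<forall>t>0. white_noise_pairing P
        (\<lambda>p. 1 / (2 * c) * indicator (backward_triangle x t c) p) (v x t))"

definition lower_probability :: "'a measure \<Rightarrow> ('a \<Rightarrow> 'b set) \<Rightarrow> 'b set \<Rightarrow> real" where
  "lower_probability P X B = measure P {\<omega> \<in> space P. X \<omega> \<subseteq> B}"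

section \<open>Brownian motion and exit times\<close>

definition standard_brownian_motion :: "'a measure \<Rightarrow> (real \<Rightarrow> 'a \<Rightarrow> real) \<Rightarrow> bool" where
  "standard_brownian_motion M w \<longleftrightarrow>
     prob_space M \<and>
     (\<forall>s\<ge>0. w s \<in> borel_measurable M) \<and>
     (\<forall>\<omega> \<in> space M. w 0 \<omega> = 0 \<and> continuous_on {0..} (\<lambda>s. w s \<omega>)) \<and>
     (\<forall>r s. 0 \<le> r \<and> r < s \<longrightarrow>
        distributed M lborel (\<lambda>\<omega>. w s \<omega> - w r \<omega>) (normal_density 0 (sqrt (s - r)))) \<and>
     (\<forall>(T :: nat \<Rightarrow> real) n. 0 \<le> T 0 \<and> incseq T \<longrightarrow>
        prob_space.indep_vars M (\<lambda>_. borel) (\<lambda>i \<omega>. w (T (Suc i)) \<omega> - w (T i) \<omega>) {..<n})"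

text \<open>The value is infinite on paths that never leave the interval.  By continuity of the
  paths the infimum is otherwise a minimum.\<close>

definition exit_time :: "(real \<Rightarrow> 'a \<Rightarrow> real) \<Rightarrow> real \<Rightarrow> real \<Rightarrow> 'a \<Rightarrow> ereal" where
  "exit_time w a b \<omega> = Inf (ereal ` {s. 0 \<le> s \<and> w s \<omega> \<notin> {a<..<b}})"

definition exit_time_cdf ::
  "'a measure \<Rightarrow> (real \<Rightarrow> 'a \<Rightarrow> real) \<Rightarrow> real \<Rightarrow> real \<Rightarrow> real \<Rightarrow> real" where
  "exit_time_cdf M w a b s = measure M {\<omega> \<in> space M. exit_time w a b \<omega> \<le> ereal s}"

end

theory Submission
  imports Defs
begin

text \<open>
  The value \<open>u\<^sub>c(x, t)\<close> is white noise applied to the indicator function of a triangle, divided by \<open>2 c\<close>.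
  Two triangles with the same vertex are nested, and the one of speed \<open>c\<close> has area \<open>c t\<^sup>2\<close>; hence,
  for \<open>r = 1 / c\<close>, the Gaussian process \<open>V\<^sub>r = (2 / t) u\<^bsub>1/r\<^esub>(x, t)\<close> has covariance \<open>min r r'\<close>
  (lemma \<open>char_rescaled_solution\<close>).  So \<open>V\<close> is a Brownian motion in the reciprocal speed, and \<open>X\<close>
  lies in \<open>B\<close> if and only if \<open>V\<close> stays in \<open>(2 / t) B\<close> while \<open>r\<close> runs from \<open>rl\<close> to \<open>ru\<close>.  At time \<open>rl\<close>
  the process is normally distributed with density \<open>g\<close>, and from there on it is a Brownian motion
  started at an independent point \<open>y\<close>; conditioning on \<open>y\<close> gives the integral of the probabilities
  that the exit time from the interval shifted by \<open>- y\<close> exceeds \<open>ru - rl\<close>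
  (lemma \<open>normal_start_stay_probability\<close>).

  The identification of \<open>V\<close> with Brownian motion is carried out through characteristic functions.
  Linear combinations of pairings with white noise are again such pairings, and their
  characteristic function is explicit (\<open>char_white_noise_pairing\<close>).  It agrees with that of the
  same linear combination of values of a Brownian motion \<open>w\<close> with an independent normal start
  (\<open>char_shifted_start\<close>), and this determines the probability that finitely many values all
  lie in prescribed sets (\<open>box_probabilities_determined_by_char\<close>).  By continuity of the paths, the
  event of staying in an open interval is a union over margins of intersections over dyadic
  grids of such finite events (\<open>stays_on_grids_iff\<close>), so its probability is the same for both
  processes (\<open>stays_on_grids_prob_cong\<close>).
\<close>

section \<open>Joint laws and characteristic functions\<close>

text \<open>A weight \<open>R \<ge> 1\<close> can be normalised to a probability density.  The law of \<open>Y\<close> under the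
  reweighted measure then has the given weighted integrals, divided by the total mass, as its
  characteristic function, so one-dimensional uniqueness applies.  The total mass is the case
  \<open>\<theta> = 0\<close>.\<close>

lemma weighted_law_determined_by_char:
  fixes Y R :: "'a \<Rightarrow> real" and Y' R' :: "'b \<Rightarrow> real"
  assumes "prob_space N" "prob_space N'"
    and [measurable]: "Y \<in> borel_measurable N" "R \<in> borel_measurable N"
      "Y' \<in> borel_measurable N'" "R' \<in> borel_measurable N'"
    and R: "\<And>\<omega>. 1 \<le> R \<omega> \<and> R \<omega> \<le> K" and R': "\<And>\<omega>. 1 \<le> R' \<omega> \<and> R' \<omega> \<le> K"
    and eq: "\<And>\<theta>. (\<integral>\<omega>. of_real (R \<omega>) * iexp (\<theta> * Y \<omega>) \<partial>N) = (\<integral>\<omega>. of_real (R' \<omega>) * iexp (\<theta> * Y' \<omega>) \<partial>N')"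
    and A[measurable]: "A \<in> sets borel"
  shows "(\<integral>\<omega>. R \<omega> * indicator A (Y \<omega>) \<partial>N) = (\<integral>\<omega>. R' \<omega> * indicator A (Y' \<omega>) \<partial>N')"
proof -
  define c where "c = (\<integral>\<omega>. R \<omega> \<partial>N)"
  define c' where "c' = (\<integral>\<omega>. R' \<omega> \<partial>N')"
  have key: "1 \<le> k \<and> real_distribution (distr (density M (\<lambda>\<omega>. ennreal (S \<omega> / k))) borel Z)
      \<and> (\<forall>\<theta>. char (distr (density M (\<lambda>\<omega>. ennreal (S \<omega> / k))) borel Z) \<theta>
            = (\<integral>\<omega>. of_real (S \<omega>) * iexp (\<theta> * Z \<omega>) \<partial>M) / of_real k)
      \<and> measure (distr (density M (\<lambda>\<omega>. ennreal (S \<omega> / k))) borel Z) A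
            = (\<integral>\<omega>. S \<omega> * indicator A (Z \<omega>) \<partial>M) / k"
    if M: "prob_space M" and [measurable]: "Z \<in> borel_measurable M" "S \<in> borel_measurable M"
      and S: "\<And>\<omega>. 1 \<le> S \<omega> \<and> S \<omega> \<le> K" and k: "k = (\<integral>\<omega>. S \<omega> \<partial>M)"
    for M :: "'z measure" and Z S k
  proof -
    interpret M: prob_space M by fact
    have int: "integrable M S"
      by (intro M.integrable_const_bound[where B = K] AE_I2) (use S in \<open>auto simp: abs_le_iff, smt (verit) S\<close>)
    have k1: "1 \<le> k"
      using integral_mono[OF M.integrable_const int, of 1] S by (simp add: k M.prob_space)
    have pos: "0 \<le> S \<omega> / k" for \<omega> using S[of \<omega>] k1 by simp
    have "emeasure (density M (\<lambda>\<omega>. ennreal (S \<omega> / k))) (space M) = (\<integral>\<^sup>+\<omega>. ennreal (S \<omega> / k) \<partial>M)"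
      by (subst emeasure_density) (auto intro!: nn_integral_cong)
    also have "\<dots> = ennreal (\<integral>\<omega>. S \<omega> / k \<partial>M)"
      using int pos by (intro nn_integral_eq_integral) (auto intro!: Bochner_Integration.integrable_divide)
    also have "\<dots> = 1" using k1 by (simp add: k[symmetric])
    finally have D: "prob_space (density M (\<lambda>\<omega>. ennreal (S \<omega> / k)))"
      by (intro prob_spaceI) simp
    interpret D: prob_space "density M (\<lambda>\<omega>. ennreal (S \<omega> / k))" by fact
    have rd: "real_distribution (distr (density M (\<lambda>\<omega>. ennreal (S \<omega> / k))) borel Z)"
      by (rule D.real_distribution_distr) simp
    have ch: "char (distr (density M (\<lambda>\<omega>. ennreal (S \<omega> / k))) borel Z) \<theta>
            = (\<integral>\<omega>. of_real (S \<omega>) * iexp (\<theta> * Z \<omega>) \<partial>M) / of_real k" for \<theta>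
    proof -
      have "char (distr (density M (\<lambda>\<omega>. ennreal (S \<omega> / k))) borel Z) \<theta>
          = (\<integral>\<omega>. (S \<omega> / k) *\<^sub>R iexp (\<theta> * Z \<omega>) \<partial>M)"
        unfolding char_def using pos by (simp add: integral_distr integral_density)
      also have "\<dots> = (\<integral>\<omega>. (of_real (S \<omega>) * iexp (\<theta> * Z \<omega>)) / of_real k \<partial>M)"
        by (simp add: scaleR_conv_of_real)
      finally show ?thesis by simp
    qed
    have "measure (distr (density M (\<lambda>\<omega>. ennreal (S \<omega> / k))) borel Z) A
       = (\<integral>x. indicator A x \<partial>distr (density M (\<lambda>\<omega>. ennreal (S \<omega> / k))) borel Z)"
      by simp
    also have "\<dots> = (\<integral>\<omega>. (S \<omega> / k) *\<^sub>R indicator A (Z \<omega>) \<partial>M)"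
      using pos by (subst integral_distr) (simp_all add: integral_density)
    also have "\<dots> = (\<integral>\<omega>. S \<omega> * indicator A (Z \<omega>) / k \<partial>M)" by simp
    finally show ?thesis using k1 rd ch by simp
  qed
  note K = key[OF assms(1,3,4) R c_def] and K' = key[OF assms(2,5,6) R' c'_def]
  have "of_real c = (\<integral>\<omega>. of_real (R \<omega>) * iexp (0 * Y \<omega>) \<partial>N)" by (simp add: c_def)
  also have "\<dots> = of_real c'" unfolding eq by (simp add: c'_def)
  finally have cc: "c = c'" using of_real_eq_iff by blast
  have "distr (density N (\<lambda>\<omega>. ennreal (R \<omega> / c))) borel Y = distr (density N' (\<lambda>\<omega>. ennreal (R' \<omega> / c'))) borel Y'"
  proof (rule Levy_uniqueness)
    show "char (distr (density N (\<lambda>\<omega>. ennreal (R \<omega> / c))) borel Y) = char (distr (density N' (\<lambda>\<omega>. ennreal (R' \<omega> / c'))) borel Y')"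
      using K K' by (intro ext) (simp only: eq cc)
  qed (use K K' in simp_all)
  then have "(\<integral>\<omega>. R \<omega> * indicator A (Y \<omega>) \<partial>N) / c = (\<integral>\<omega>. R' \<omega> * indicator A (Y' \<omega>) \<partial>N') / c'"
    using K K' by metis
  then show ?thesis using K cc by simp
qed

text \<open>A complex weight \<open>W\<close> is reduced to the weights \<open>2 + Re W\<close> and \<open>2 + Im W\<close>, which lie between
  1 and 3; the additive constant is removed again with the help of the unweighted law.\<close>

lemma complex_weighted_law_determined_by_char:
  fixes Y :: "'a \<Rightarrow> real" and Y' :: "'b \<Rightarrow> real" and W :: "'a \<Rightarrow> complex" and W' :: "'b \<Rightarrow> complex"
  assumes N: "prob_space N" and N': "prob_space N'"
    and [measurable]: "Y \<in> borel_measurable N" "W \<in> borel_measurable N"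
      "Y' \<in> borel_measurable N'" "W' \<in> borel_measurable N'"
    and W: "\<And>\<omega>. norm (W \<omega>) \<le> 1" and W': "\<And>\<omega>. norm (W' \<omega>) \<le> 1"
    and eq: "\<And>\<theta>. (\<integral>\<omega>. W \<omega> * iexp (\<theta> * Y \<omega>) \<partial>N) = (\<integral>\<omega>. W' \<omega> * iexp (\<theta> * Y' \<omega>) \<partial>N')"
    and law: "\<And>\<theta>. (\<integral>\<omega>. iexp (\<theta> * Y \<omega>) \<partial>N) = (\<integral>\<omega>. iexp (\<theta> * Y' \<omega>) \<partial>N')"
    and A[measurable]: "A \<in> sets borel"
  shows "(\<integral>\<omega>. W \<omega> * indicator A (Y \<omega>) \<partial>N) = (\<integral>\<omega>. W' \<omega> * indicator A (Y' \<omega>) \<partial>N')"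
proof -
  interpret N: prob_space N by fact
  interpret N': prob_space N' by fact
  have intN: "integrable N f" if "f \<in> borel_measurable N" "\<And>\<omega>. norm (f \<omega>) \<le> 1" for f :: "'a \<Rightarrow> complex"
    using that by (intro N.integrable_const_bound[where B = 1]) auto
  have intN': "integrable N' f" if "f \<in> borel_measurable N'" "\<And>\<omega>. norm (f \<omega>) \<le> 1" for f :: "'b \<Rightarrow> complex"
    using that by (intro N'.integrable_const_bound[where B = 1]) auto
  have rintN: "integrable N f" if "f \<in> borel_measurable N" "\<And>\<omega>. norm (f \<omega>) \<le> 1" for f :: "'a \<Rightarrow> real"
    using that by (intro N.integrable_const_bound[where B = 1]) auto
  have rintN': "integrable N' f" if "f \<in> borel_measurable N'" "\<And>\<omega>. norm (f \<omega>) \<le> 1" for f :: "'b \<Rightarrow> real"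
    using that by (intro N'.integrable_const_bound[where B = 1]) auto
  have [measurable]: "cnj \<in> borel_measurable borel"
    by (intro borel_measurable_continuous_onI continuous_intros)
  have real_part: "(\<integral>\<omega>. Re (z * W \<omega>) * indicator A (Y \<omega>) \<partial>N) = (\<integral>\<omega>. Re (z * W' \<omega>) * indicator A (Y' \<omega>) \<partial>N')"
    if z: "norm z = 1" for z
  proof -
    have zW: "norm (z * W \<omega>) \<le> 1" for \<omega> using W[of \<omega>] z by (simp add: norm_mult)
    have zW': "norm (z * W' \<omega>) \<le> 1" for \<omega> using W'[of \<omega>] z by (simp add: norm_mult)
    have re: "\<bar>Re (z * W \<omega>)\<bar> \<le> 1" for \<omega> using abs_Re_le_cmod[of "z * W \<omega>"] zW[of \<omega>] by linarith
    have re': "\<bar>Re (z * W' \<omega>)\<bar> \<le> 1" for \<omega> using abs_Re_le_cmod[of "z * W' \<omega>"] zW'[of \<omega>] by linarith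
    have eqz: "(\<integral>\<omega>. z * W \<omega> * iexp (\<theta> * Y \<omega>) \<partial>N) = (\<integral>\<omega>. z * W' \<omega> * iexp (\<theta> * Y' \<omega>) \<partial>N')" for \<theta>
      using eq[of \<theta>] by (simp add: mult.assoc)
    \<comment> \<open>The conjugate weight is covered by the hypothesis at \<open>-\<theta>\<close>.\<close>
    have cnj: "(\<integral>\<omega>. cnj (z * W \<omega>) * iexp (\<theta> * Y \<omega>) \<partial>N) = (\<integral>\<omega>. cnj (z * W' \<omega>) * iexp (\<theta> * Y' \<omega>) \<partial>N')" for \<theta>
    proof -
      have "(\<integral>\<omega>. cnj (z * W \<omega>) * iexp (\<theta> * Y \<omega>) \<partial>N) = (\<integral>\<omega>. cnj (z * W \<omega> * iexp ((-\<theta>) * Y \<omega>)) \<partial>N)"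
        by (simp add: exp_cnj)
      also have "\<dots> = (\<integral>\<omega>. cnj (z * W' \<omega> * iexp ((-\<theta>) * Y' \<omega>)) \<partial>N')"
        by (simp only: Bochner_Integration.integral_cnj eqz)
      also have "\<dots> = (\<integral>\<omega>. cnj (z * W' \<omega>) * iexp (\<theta> * Y' \<omega>) \<partial>N')"
        by (simp add: exp_cnj)
      finally show ?thesis .
    qed
    have split: "of_real (2 + Re v) * e = 2 * e + (v * e + cnj v * e) / 2" for v e :: complex
      unfolding distrib_right[symmetric] complex_add_cnj by (simp add: distrib_right)
    have "(\<integral>\<omega>. (2 + Re (z * W \<omega>)) * indicator A (Y \<omega>) \<partial>N) = (\<integral>\<omega>. (2 + Re (z * W' \<omega>)) * indicator A (Y' \<omega>) \<partial>N')"
    proof (rule weighted_law_determined_by_char[OF N N', where K = 3])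
      fix \<theta>
      have "(\<integral>\<omega>. of_real (2 + Re (z * W \<omega>)) * iexp (\<theta> * Y \<omega>) \<partial>N)
        = 2 * (\<integral>\<omega>. iexp (\<theta> * Y \<omega>) \<partial>N) + ((\<integral>\<omega>. z * W \<omega> * iexp (\<theta> * Y \<omega>) \<partial>N)
            + (\<integral>\<omega>. cnj (z * W \<omega>) * iexp (\<theta> * Y \<omega>) \<partial>N)) / 2"
      proof -
        have "integrable N (\<lambda>\<omega>. iexp (\<theta> * Y \<omega>))" "integrable N (\<lambda>\<omega>. z * W \<omega> * iexp (\<theta> * Y \<omega>))"
          "integrable N (\<lambda>\<omega>. cnj (z * W \<omega>) * iexp (\<theta> * Y \<omega>))"
          by (rule intN; use zW in \<open>simp add: norm_mult\<close>)+
        then show ?thesis unfolding split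
          by (simp only: Bochner_Integration.integral_add Bochner_Integration.integrable_add
             Bochner_Integration.integrable_divide Bochner_Integration.integrable_mult_right
             integral_divide_zero integral_mult_right_zero)
      qed
      also have "\<dots> = 2 * (\<integral>\<omega>. iexp (\<theta> * Y' \<omega>) \<partial>N') + ((\<integral>\<omega>. z * W' \<omega> * iexp (\<theta> * Y' \<omega>) \<partial>N')
            + (\<integral>\<omega>. cnj (z * W' \<omega>) * iexp (\<theta> * Y' \<omega>) \<partial>N')) / 2"
        unfolding law eqz cnj ..
      also have "\<dots> = (\<integral>\<omega>. of_real (2 + Re (z * W' \<omega>)) * iexp (\<theta> * Y' \<omega>) \<partial>N')"
      proof -
        have "integrable N' (\<lambda>\<omega>. iexp (\<theta> * Y' \<omega>))" "integrable N' (\<lambda>\<omega>. z * W' \<omega> * iexp (\<theta> * Y' \<omega>))"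
          "integrable N' (\<lambda>\<omega>. cnj (z * W' \<omega>) * iexp (\<theta> * Y' \<omega>))"
          by (rule intN'; use zW' in \<open>simp add: norm_mult\<close>)+
        then show ?thesis unfolding split
          by (simp only: Bochner_Integration.integral_add Bochner_Integration.integrable_add
             Bochner_Integration.integrable_divide Bochner_Integration.integrable_mult_right
             integral_divide_zero integral_mult_right_zero)
      qed
      finally show "(\<integral>\<omega>. of_real (2 + Re (z * W \<omega>)) * iexp (\<theta> * Y \<omega>) \<partial>N)
        = (\<integral>\<omega>. of_real (2 + Re (z * W' \<omega>)) * iexp (\<theta> * Y' \<omega>) \<partial>N')" .
    next
      show "1 \<le> 2 + Re (z * W \<omega>) \<and> 2 + Re (z * W \<omega>) \<le> 3" for \<omega> using re[of \<omega>] by linarith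
      show "1 \<le> 2 + Re (z * W' \<omega>) \<and> 2 + Re (z * W' \<omega>) \<le> 3" for \<omega> using re'[of \<omega>] by linarith
    qed simp_all
    moreover have "(\<integral>\<omega>. 1 * indicator A (Y \<omega>) \<partial>N) = (\<integral>\<omega>. 1 * indicator A (Y' \<omega>) \<partial>N' :: real)"
      by (rule weighted_law_determined_by_char[OF N N', where K = 1]) (use law in simp_all)
    moreover have "(\<integral>\<omega>. (2 + Re (z * W \<omega>)) * indicator A (Y \<omega>) \<partial>N)
        = 2 * (\<integral>\<omega>. 1 * indicator A (Y \<omega>) \<partial>N) + (\<integral>\<omega>. Re (z * W \<omega>) * indicator A (Y \<omega>) \<partial>N)"
      unfolding distrib_right using re
      by (subst Bochner_Integration.integral_add) (auto intro!: rintN simp: indicator_def)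
    moreover have "(\<integral>\<omega>. (2 + Re (z * W' \<omega>)) * indicator A (Y' \<omega>) \<partial>N')
        = 2 * (\<integral>\<omega>. 1 * indicator A (Y' \<omega>) \<partial>N') + (\<integral>\<omega>. Re (z * W' \<omega>) * indicator A (Y' \<omega>) \<partial>N')"
      unfolding distrib_right using re'
      by (subst Bochner_Integration.integral_add) (auto intro!: rintN' simp: indicator_def)
    ultimately show ?thesis by linarith
  qed
  have i1: "integrable N (\<lambda>\<omega>. W \<omega> * indicator A (Y \<omega>))"
    by (rule intN) (auto simp: norm_mult indicator_def W)
  have i2: "integrable N' (\<lambda>\<omega>. W' \<omega> * indicator A (Y' \<omega>))"
    by (rule intN') (auto simp: norm_mult indicator_def W')
  have indR: "Re (indicator A y) = indicator A y" "Im (indicator A y) = 0" for y :: real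
    by (auto simp: indicator_def)
  show ?thesis
    using real_part[of 1] real_part[of "-\<i>"] i1 i2
    by (intro complex_eqI) (simp_all add: indR flip: integral_Re integral_Im)
qed

text \<open>A finite-dimensional uniqueness theorem in the spirit of Cramer and Wold, obtained from the
  one-dimensional one: the factors \<open>exp (\<i> \<theta>\<^sub>k Y\<^sub>k)\<close> are exchanged one at a time for the
  indicators of \<open>Y\<^sub>k \<in> A\<^sub>k\<close>, all the other factors being treated as a complex weight.\<close>

lemma box_probabilities_determined_by_char:
  fixes Y :: "nat \<Rightarrow> 'a \<Rightarrow> real" and Y' :: "nat \<Rightarrow> 'b \<Rightarrow> real"
  assumes N: "prob_space N" and N': "prob_space N'"
    and [measurable]: "\<And>j. j < n \<Longrightarrow> Y j \<in> borel_measurable N" "\<And>j. j < n \<Longrightarrow> Y' j \<in> borel_measurable N'"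
    and eq: "\<And>\<theta>. (\<integral>\<omega>. iexp (\<Sum>j<n. \<theta> j * Y j \<omega>) \<partial>N) = (\<integral>\<omega>. iexp (\<Sum>j<n. \<theta> j * Y' j \<omega>) \<partial>N')"
    and A[measurable]: "\<And>j. A j \<in> sets borel"
  shows "measure N {\<omega> \<in> space N. \<forall>j<n. Y j \<omega> \<in> A j} = measure N' {\<omega> \<in> space N'. \<forall>j<n. Y' j \<omega> \<in> A j}"
proof -
  have step: "(\<integral>\<omega>. (\<Prod>j<k. indicator (A j) (Y j \<omega>)) * iexp (\<Sum>j=k..<n. \<theta> j * Y j \<omega>) \<partial>N)
     = (\<integral>\<omega>. (\<Prod>j<k. indicator (A j) (Y' j \<omega>)) * iexp (\<Sum>j=k..<n. \<theta> j * Y' j \<omega>) \<partial>N')"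
    if "k \<le> n" for k \<theta>
    using that
  proof (induction k arbitrary: \<theta>)
    case 0
    then show ?case using eq[of \<theta>] by (simp add: atLeast0LessThan)
  next
    case (Suc k)
    then have k: "k < n" by simp
    have upd: "(\<Sum>j=k..<n. (\<theta>(k := s)) j * f j) = s * f k + (\<Sum>j=Suc k..<n. \<theta> j * f j)" for s and f :: "nat \<Rightarrow> real"
      using k by (subst sum.atLeast_Suc_lessThan) (auto intro!: sum.cong)
    have single: "(\<Sum>j<n. (if j = k then s else 0) * f j) = s * f k" for s and f :: "nat \<Rightarrow> real"
      using k by (simp add: if_distrib[of "\<lambda>x. x * _"] cong: if_cong)
    have prod_le: "cmod (\<Prod>j<k. indicator (A j) (f j)) \<le> 1" for f
      unfolding prod_norm[symmetric] by (rule prod_le_1) (auto simp: indicator_def)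
    have "(\<integral>\<omega>. (\<Prod>j<k. indicator (A j) (Y j \<omega>)) * iexp (\<Sum>j=Suc k..<n. \<theta> j * Y j \<omega>) * indicator (A k) (Y k \<omega>) \<partial>N)
     = (\<integral>\<omega>. (\<Prod>j<k. indicator (A j) (Y' j \<omega>)) * iexp (\<Sum>j=Suc k..<n. \<theta> j * Y' j \<omega>) * indicator (A k) (Y' k \<omega>) \<partial>N')"
    proof (rule complex_weighted_law_determined_by_char[OF N N'])
      fix s
      show "(\<integral>\<omega>. (\<Prod>j<k. indicator (A j) (Y j \<omega>)) * iexp (\<Sum>j=Suc k..<n. \<theta> j * Y j \<omega>) * iexp (s * Y k \<omega>) \<partial>N)
       = (\<integral>\<omega>. (\<Prod>j<k. indicator (A j) (Y' j \<omega>)) * iexp (\<Sum>j=Suc k..<n. \<theta> j * Y' j \<omega>) * iexp (s * Y' k \<omega>) \<partial>N')"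
        using Suc.IH[of "\<theta>(k := s)"] k unfolding upd
        by (simp add: exp_add distrib_left mult_ac)
      show "(\<integral>\<omega>. iexp (s * Y k \<omega>) \<partial>N) = (\<integral>\<omega>. iexp (s * Y' k \<omega>) \<partial>N')"
        using eq[of "\<lambda>j. if j = k then s else 0"] unfolding single .
    next
      show "cmod ((\<Prod>j<k. indicator (A j) (Y j \<omega>)) * iexp (\<Sum>j=Suc k..<n. \<theta> j * Y j \<omega>)) \<le> 1" for \<omega>
        unfolding norm_mult norm_exp_i_times using prod_le by simp
      show "cmod ((\<Prod>j<k. indicator (A j) (Y' j \<omega>)) * iexp (\<Sum>j=Suc k..<n. \<theta> j * Y' j \<omega>)) \<le> 1" for \<omega>
        unfolding norm_mult norm_exp_i_times using prod_le by simp
    qed (use k in \<open>auto intro!: borel_measurable_times borel_measurable_prod\<close>)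
    then show ?case by (simp add: mult_ac)
  qed
  have ind: "(\<integral>\<omega>. (\<Prod>j<n. indicator (A j) (Z j \<omega>)) * iexp (\<Sum>j=n..<n. 0 * Z j \<omega>) \<partial>M)
      = complex_of_real (measure M {\<omega> \<in> space M. \<forall>j<n. Z j \<omega> \<in> A j})"
    if [measurable]: "\<And>j. j < n \<Longrightarrow> Z j \<in> borel_measurable M" for M :: "'z measure" and Z
  proof -
    have prod: "(\<Prod>j<n. indicator (A j) (f j)) = (if \<forall>j<n. f j \<in> A j then 1 else 0 :: complex)" for f :: "nat \<Rightarrow> real"
    proof (cases "\<forall>j<n. f j \<in> A j")
      case False
      then obtain j where "j < n" "f j \<notin> A j" by blast
      then have "(\<Prod>j<n. indicator (A j) (f j)) = (0::complex)"
        by (intro prod_zero) (auto simp: indicator_def intro!: bexI[of _ j])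
      then show ?thesis using False by simp
    qed (simp add: indicator_def)
    have "(\<integral>\<omega>. (\<Prod>j<n. indicator (A j) (Z j \<omega>)) * iexp (\<Sum>j=n..<n. 0 * Z j \<omega>) \<partial>M)
       = (\<integral>\<omega>. of_real (indicator {\<omega> \<in> space M. \<forall>j<n. Z j \<omega> \<in> A j} \<omega>) \<partial>M)"
      by (intro Bochner_Integration.integral_cong) (auto simp: prod indicator_def)
    also have "\<dots> = complex_of_real (\<integral>\<omega>. indicator {\<omega> \<in> space M. \<forall>j<n. Z j \<omega> \<in> A j} \<omega> \<partial>M)"
      by (simp add: integral_complex_of_real)
    also have "(\<integral>\<omega>. indicator {\<omega> \<in> space M. \<forall>j<n. Z j \<omega> \<in> A j} \<omega> \<partial>M) = measure M {\<omega> \<in> space M. \<forall>j<n. Z j \<omega> \<in> A j}"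
      by (simp add: Int_absorb2 Collect_conj_eq[symmetric])
    finally show ?thesis .
  qed
  have "complex_of_real (measure N {\<omega> \<in> space N. \<forall>j<n. Y j \<omega> \<in> A j})
      = complex_of_real (measure N' {\<omega> \<in> space N'. \<forall>j<n. Y' j \<omega> \<in> A j})"
    by (subst (1 2) ind[symmetric]) (use assms(3,4) step[OF order_refl, of "\<lambda>_. 0"] in auto)
  then show ?thesis by (rule of_real_eq_iff[THEN iffD1])
qed

section \<open>Linearity and measurability of white noise\<close>

lemma iter_pderiv_lincomb:
  assumes f: "f \<in> schwartz_functions" and g: "g \<in> schwartz_functions" and es: "es \<in> lists Basis"
  shows "iter_pderiv es (\<lambda>p. a * f p + b * g p) = (\<lambda>p. a * iter_pderiv es f p + b * iter_pderiv es g p)"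
  using es
proof (induction es)
  case (Cons e es)
  then have es: "es \<in> lists Basis" by simp
  have df: "iter_pderiv es f differentiable at p" and dg: "iter_pderiv es g differentiable at p" for p
    using f g es by (auto simp: schwartz_functions_def differentiable_on_def)
  have "pderiv_along e (\<lambda>p. a * iter_pderiv es f p + b * iter_pderiv es g p) p
    = a * pderiv_along e (iter_pderiv es f) p + b * pderiv_along e (iter_pderiv es g) p" for p
  proof -
    have "((\<lambda>p. a * iter_pderiv es f p + b * iter_pderiv es g p) has_derivative
       (\<lambda>h. a * frechet_derivative (iter_pderiv es f) (at p) h + b * frechet_derivative (iter_pderiv es g) (at p) h)) (at p)"
      using df[of p] dg[of p] unfolding frechet_derivative_works
      by (intro has_derivative_add has_derivative_mult_right)
    from frechet_derivative_at[OF this, symmetric] show ?thesis by (simp add: pderiv_along_def)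
  qed
  then show ?case by (simp add: Cons.IH fun_eq_iff)
qed simp

text \<open>Needed because linear combinations of approximating Schwartz functions have to be admissible
  approximations of linear combinations of square integrable functions.\<close>

lemma schwartz_functions_lincomb:
  assumes f: "f \<in> schwartz_functions" and g: "g \<in> schwartz_functions"
  shows "(\<lambda>p. a * f p + b * g p) \<in> schwartz_functions"
  unfolding schwartz_functions_def
proof (intro CollectI ballI conjI allI)
  fix es :: "'a list" assume es: "es \<in> lists Basis"
  have df: "iter_pderiv es f differentiable_on UNIV" and dg: "iter_pderiv es g differentiable_on UNIV"
    using f g es by (auto simp: schwartz_functions_def)
  then show "iter_pderiv es (\<lambda>p. a * f p + b * g p) differentiable_on UNIV"
    unfolding iter_pderiv_lincomb[OF f g es] by (intro derivative_intros)
  fix N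
  have "bounded (range (\<lambda>p. (1 + norm p) ^ N * iter_pderiv es f p))"
    "bounded (range (\<lambda>p. (1 + norm p) ^ N * iter_pderiv es g p))"
    using f g es by (auto simp: schwartz_functions_def)
  then obtain F G where F: "\<And>p. \<bar>(1 + norm p) ^ N * iter_pderiv es f p\<bar> \<le> F"
     and G: "\<And>p. \<bar>(1 + norm p) ^ N * iter_pderiv es g p\<bar> \<le> G"
    unfolding bounded_iff by auto
  have "\<bar>(1 + norm p) ^ N * (a * iter_pderiv es f p + b * iter_pderiv es g p)\<bar> \<le> \<bar>a\<bar> * F + \<bar>b\<bar> * G" for p
  proof -
    have "\<bar>(1 + norm p) ^ N * (a * iter_pderiv es f p + b * iter_pderiv es g p)\<bar>
       = \<bar>a * ((1 + norm p) ^ N * iter_pderiv es f p) + b * ((1 + norm p) ^ N * iter_pderiv es g p)\<bar>"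
      by (simp add: algebra_simps)
    also have "\<dots> \<le> \<bar>a\<bar> * \<bar>(1 + norm p) ^ N * iter_pderiv es f p\<bar> + \<bar>b\<bar> * \<bar>(1 + norm p) ^ N * iter_pderiv es g p\<bar>"
      by (rule order_trans[OF abs_triangle_ineq]) (simp add: abs_mult)
    also have "\<dots> \<le> \<bar>a\<bar> * F + \<bar>b\<bar> * G"
      by (intro add_mono mult_left_mono F G) auto
    finally show ?thesis .
  qed
  then show "bounded (range (\<lambda>p. (1 + norm p) ^ N * iter_pderiv es (\<lambda>p. a * f p + b * g p) p))"
    unfolding iter_pderiv_lincomb[OF f g es] bounded_iff by auto
qed

lemma schwartz_functions_borel_measurable:
  "f \<in> schwartz_functions \<Longrightarrow> f \<in> borel_measurable borel"
proof -
  assume "f \<in> schwartz_functions"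
  then have "iter_pderiv [] f differentiable_on UNIV"
    unfolding schwartz_functions_def by blast
  then show ?thesis
    by (intro borel_measurable_continuous_onI differentiable_imp_continuous_on) simp
qed

lemma half_plane_borel [measurable]: "half_plane \<in> sets borel"
  unfolding half_plane_def by (intro borel_closed closed_Times) auto

lemma topspace_weak_star: "topspace weak_star_topology = tempered_half_plane"
  unfolding weak_star_topology_def by (auto simp: tempered_half_plane_def PiE_def)

lemma open_weak_star_subset: "{U. openin weak_star_topology U} \<subseteq> Pow tempered_half_plane"
  using openin_subset topspace_weak_star by blast

lemma space_weak_star_borel: "space weak_star_borel = tempered_half_plane"
  unfolding weak_star_borel_def by (rule space_measure_of[OF open_weak_star_subset])

lemma space_white_noise:
  assumes "white_noise_space P" shows "space P = tempered_half_plane"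
proof -
  obtain P0 where "sets P0 = sets weak_star_borel" "P = completion P0"
    using assms unfolding white_noise_space_def by blast
  then show ?thesis using sets_eq_imp_space_eq[of P0 weak_star_borel] space_weak_star_borel by simp
qed

lemma prob_space_white_noise:
  assumes "white_noise_space P" shows "prob_space P"
  using assms prob_space.prob_space_completion unfolding white_noise_space_def by blast

lemma evaluation_measurable:
  assumes f: "f \<in> schwartz_half_plane"
  shows "(\<lambda>\<omega>. \<omega> f) \<in> borel_measurable weak_star_borel"
proof (rule borel_measurableI)
  fix U :: "real set" assume U: "open U"
  have "continuous_map weak_star_topology euclideanreal (\<lambda>\<omega>. \<omega> f)"
    unfolding weak_star_topology_def
    by (intro continuous_map_from_subtopology continuous_map_product_projection f)
  then have "openin weak_star_topology {\<omega> \<in> tempered_half_plane. \<omega> f \<in> U}"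
    using U unfolding continuous_map_def topspace_weak_star by auto
  then show "(\<lambda>\<omega>. \<omega> f) -` U \<inter> space weak_star_borel \<in> sets weak_star_borel"
    unfolding space_weak_star_borel unfolding weak_star_borel_def sets_measure_of[OF open_weak_star_subset]
    by (intro sigma_sets.Basic) (simp add: vimage_def Int_def conj_commute)
qed

lemma white_noise_measurable:
  assumes P: "white_noise_space P" and \<phi>: "\<phi> \<in> schwartz_functions"
  shows "white_noise \<phi> \<in> borel_measurable P"
proof -
  obtain P0 where "sets P0 = sets weak_star_borel" and P: "P = completion P0"
    using P unfolding white_noise_space_def by blast
  moreover have "restrict \<phi> half_plane \<in> schwartz_half_plane"
    using \<phi> unfolding schwartz_half_plane_def by blast
  ultimately have "white_noise \<phi> \<in> borel_measurable P0"
    using evaluation_measurable measurable_cong_sets unfolding white_noise_def by blast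
  then show ?thesis unfolding P by (rule measurable_completion)
qed

lemma white_noise_lincomb:
  assumes P: "white_noise_space P" and f: "f \<in> schwartz_functions" and g: "g \<in> schwartz_functions" and \<omega>: "\<omega> \<in> space P"
  shows "white_noise (\<lambda>p. a * f p + b * g p) \<omega> = a * white_noise f \<omega> + b * white_noise g \<omega>"
proof -
  have "restrict f half_plane \<in> schwartz_half_plane" "restrict g half_plane \<in> schwartz_half_plane"
    using f g unfolding schwartz_half_plane_def by blast+
  then have "\<omega> (\<lambda>p\<in>half_plane. a * restrict f half_plane p + b * restrict g half_plane p)
    = a * \<omega> (restrict f half_plane) + b * \<omega> (restrict g half_plane)"
    using \<omega> unfolding space_white_noise[OF P] tempered_half_plane_def by blast
  moreover have "(\<lambda>p\<in>half_plane. a * restrict f half_plane p + b * restrict g half_plane p)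
     = restrict (\<lambda>p. a * f p + b * g p) half_plane"
    by auto
  ultimately show ?thesis unfolding white_noise_def by simp
qed

lemma char_white_noise:
  assumes P: "white_noise_space P" and \<phi>: "\<phi> \<in> schwartz_functions"
  shows "(\<integral>\<omega>. iexp (white_noise \<phi> \<omega>) \<partial>P) = of_real (exp (- (LINT p:half_plane|lborel. (\<phi> p)\<^sup>2) / 2))"
proof -
  obtain P0 where sets: "sets P0 = sets weak_star_borel" and P: "P = completion P0"
    and ch: "\<And>\<phi>. \<phi> \<in> schwartz_half_plane \<Longrightarrow> (\<integral>\<omega>. exp (\<i> * complex_of_real (\<omega> \<phi>)) \<partial>P0) =
             complex_of_real (exp (- (1/2) * (LINT p:half_plane|lborel. (\<phi> p)\<^sup>2)))"
    using P unfolding white_noise_space_def by blast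
  have r: "restrict \<phi> half_plane \<in> schwartz_half_plane"
    using \<phi> unfolding schwartz_half_plane_def by blast
  then have [measurable]: "white_noise \<phi> \<in> borel_measurable P0"
    using sets evaluation_measurable measurable_cong_sets unfolding white_noise_def by blast
  have "(LINT p:half_plane|lborel. (restrict \<phi> half_plane p)\<^sup>2) = (LINT p:half_plane|lborel. (\<phi> p)\<^sup>2)"
    unfolding set_lebesgue_integral_def by (intro Bochner_Integration.integral_cong) (auto simp: indicator_def)
  then show ?thesis
    using ch[OF r] unfolding P
    by (subst integral_completion) (measurable, simp add: white_noise_def)
qed

section \<open>The extension of white noise to square integrable functions\<close>

text \<open>By \<open>(a y + b z)\<^sup>2 \<le> 2 a\<^sup>2 y\<^sup>2 + 2 b\<^sup>2 z\<^sup>2\<close>; stated with nonnegative integrals, since this is how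
  the convergence in the definition of the pairing is expressed and no integrability has to be
  checked.\<close>

lemma nn_integral_sq_lincomb_tendsto_0:
  fixes u v :: "nat \<Rightarrow> 'a \<Rightarrow> real"
  assumes [measurable]: "\<And>n. u n \<in> borel_measurable M" "\<And>n. v n \<in> borel_measurable M"
    and u: "(\<lambda>n. \<integral>\<^sup>+x. ennreal ((u n x)\<^sup>2) \<partial>M) \<longlonglongrightarrow> 0"
    and v: "(\<lambda>n. \<integral>\<^sup>+x. ennreal ((v n x)\<^sup>2) \<partial>M) \<longlonglongrightarrow> 0"
  shows "(\<lambda>n. \<integral>\<^sup>+x. ennreal ((a * u n x + b * v n x)\<^sup>2) \<partial>M) \<longlonglongrightarrow> 0"
proof (rule tendsto_sandwich[OF _ _ tendsto_const])
  show "\<forall>\<^sub>F n in sequentially. (\<integral>\<^sup>+x. ennreal ((a * u n x + b * v n x)\<^sup>2) \<partial>M)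
     \<le> ennreal (2 * a\<^sup>2) * (\<integral>\<^sup>+x. ennreal ((u n x)\<^sup>2) \<partial>M) + ennreal (2 * b\<^sup>2) * (\<integral>\<^sup>+x. ennreal ((v n x)\<^sup>2) \<partial>M)"
  proof (rule always_eventually, rule allI)
    fix n
    have "(a * y + b * z)\<^sup>2 \<le> (2 * a\<^sup>2) * y\<^sup>2 + (2 * b\<^sup>2) * z\<^sup>2" for y z
      using zero_le_power2[of "a * y - b * z"] by (simp add: power2_eq_square algebra_simps)
    then have "(\<integral>\<^sup>+x. ennreal ((a * u n x + b * v n x)\<^sup>2) \<partial>M)
       \<le> (\<integral>\<^sup>+x. ennreal (2 * a\<^sup>2) * ennreal ((u n x)\<^sup>2) + ennreal (2 * b\<^sup>2) * ennreal ((v n x)\<^sup>2) \<partial>M)"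
      by (intro nn_integral_mono) (simp add: ennreal_leI flip: ennreal_mult ennreal_plus)
    then show "(\<integral>\<^sup>+x. ennreal ((a * u n x + b * v n x)\<^sup>2) \<partial>M)
     \<le> ennreal (2 * a\<^sup>2) * (\<integral>\<^sup>+x. ennreal ((u n x)\<^sup>2) \<partial>M) + ennreal (2 * b\<^sup>2) * (\<integral>\<^sup>+x. ennreal ((v n x)\<^sup>2) \<partial>M)"
      by (simp add: nn_integral_add nn_integral_cmult)
  qed
  have "(\<lambda>n. ennreal (2 * a\<^sup>2) * (\<integral>\<^sup>+x. ennreal ((u n x)\<^sup>2) \<partial>M) + ennreal (2 * b\<^sup>2) * (\<integral>\<^sup>+x. ennreal ((v n x)\<^sup>2) \<partial>M))
     \<longlonglongrightarrow> ennreal (2 * a\<^sup>2) * 0 + ennreal (2 * b\<^sup>2) * 0"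
    by (intro tendsto_add ennreal_tendsto_cmult u v) auto
  then show "(\<lambda>n. ennreal (2 * a\<^sup>2) * (\<integral>\<^sup>+x. ennreal ((u n x)\<^sup>2) \<partial>M) + ennreal (2 * b\<^sup>2) * (\<integral>\<^sup>+x. ennreal ((v n x)\<^sup>2) \<partial>M)) \<longlonglongrightarrow> 0"
    by simp
qed auto

lemma set_nn_integral_eq_restrict_space:
  assumes "A \<in> sets M"
  shows "(\<integral>\<^sup>+x\<in>A. f x \<partial>M) = (\<integral>\<^sup>+x. f x \<partial>restrict_space M A)"
  using assms by (simp add: nn_integral_restrict_space)

lemma white_noise_pairingE:
  assumes "white_noise_pairing P h X"
  obtains \<phi> where "\<And>n. \<phi> n \<in> schwartz_functions"
    and "(\<lambda>n. \<integral>\<^sup>+p\<in>half_plane. ennreal ((\<phi> n p - h p)\<^sup>2) \<partial>lborel) \<longlonglongrightarrow> 0"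
    and "(\<lambda>n. \<integral>\<^sup>+\<omega>. ennreal ((white_noise (\<phi> n) \<omega> - X \<omega>)\<^sup>2) \<partial>P) \<longlonglongrightarrow> 0"
  using assms unfolding white_noise_pairing_def
  by (elim conjE exE) (rule that[rotated], assumption, assumption, erule spec)

text \<open>Linearity of the extension by the Ito isometry.  It turns a joint statement about several
  pairings into a statement about a single one, so that no multivariate Gaussian distributions
  have to be introduced.\<close>

lemma white_noise_pairing_lincomb:
  assumes P: "white_noise_space P"
    and h: "white_noise_pairing P h X" and k: "white_noise_pairing P k Y"
  shows "white_noise_pairing P (\<lambda>p. a * h p + b * k p) (\<lambda>\<omega>. a * X \<omega> + b * Y \<omega>)"
proof -
  obtain \<phi> where \<phi>: "\<And>n. \<phi> n \<in> schwartz_functions"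
      and h1: "(\<lambda>n. \<integral>\<^sup>+p\<in>half_plane. ennreal ((\<phi> n p - h p)\<^sup>2) \<partial>lborel) \<longlonglongrightarrow> 0"
      and X: "(\<lambda>n. \<integral>\<^sup>+\<omega>. ennreal ((white_noise (\<phi> n) \<omega> - X \<omega>)\<^sup>2) \<partial>P) \<longlonglongrightarrow> 0"
    using h by (rule white_noise_pairingE) (rule that)
  obtain \<psi> where \<psi>: "\<And>n. \<psi> n \<in> schwartz_functions"
      and k1: "(\<lambda>n. \<integral>\<^sup>+p\<in>half_plane. ennreal ((\<psi> n p - k p)\<^sup>2) \<partial>lborel) \<longlonglongrightarrow> 0"
      and Y: "(\<lambda>n. \<integral>\<^sup>+\<omega>. ennreal ((white_noise (\<psi> n) \<omega> - Y \<omega>)\<^sup>2) \<partial>P) \<longlonglongrightarrow> 0"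
    using k by (rule white_noise_pairingE) (rule that)
  have meas [measurable]: "h \<in> borel_measurable lborel" "k \<in> borel_measurable lborel"
      "X \<in> borel_measurable P" "Y \<in> borel_measurable P"
    and hsq: "integrable lborel (\<lambda>p. (h p)\<^sup>2)" and ksq: "integrable lborel (\<lambda>p. (k p)\<^sup>2)"
    using h k unfolding white_noise_pairing_def by auto
  note [measurable] = white_noise_measurable[OF P \<phi>] white_noise_measurable[OF P \<psi>]
    schwartz_functions_borel_measurable[OF \<phi>] schwartz_functions_borel_measurable[OF \<psi>]
  have "integrable lborel (\<lambda>p. (a * h p + b * k p)\<^sup>2)"
  proof (rule Bochner_Integration.integrable_bound)
    show "integrable lborel (\<lambda>p. 2 * a\<^sup>2 * (h p)\<^sup>2 + 2 * b\<^sup>2 * (k p)\<^sup>2)"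
      using hsq ksq by auto
    have "(a * y + b * z)\<^sup>2 \<le> (2 * a\<^sup>2) * y\<^sup>2 + (2 * b\<^sup>2) * z\<^sup>2" for y z
      using zero_le_power2[of "a * y - b * z"] by (simp add: power2_eq_square algebra_simps)
    then show "AE p in lborel. norm ((a * h p + b * k p)\<^sup>2) \<le> norm (2 * a\<^sup>2 * (h p)\<^sup>2 + 2 * b\<^sup>2 * (k p)\<^sup>2)"
      by simp
  qed measurable
  moreover have "(\<lambda>n. \<integral>\<^sup>+p\<in>half_plane. ennreal (((a * \<phi> n p + b * \<psi> n p) - (a * h p + b * k p))\<^sup>2) \<partial>lborel) \<longlonglongrightarrow> 0"
  proof -
    have "((a * \<phi> n p + b * \<psi> n p) - (a * h p + b * k p)) = a * (\<phi> n p - h p) + b * (\<psi> n p - k p)" for n p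
      by (simp add: algebra_simps)
    moreover have "half_plane \<in> sets lborel" by simp
    ultimately show ?thesis
      using nn_integral_sq_lincomb_tendsto_0[of "\<lambda>n p. \<phi> n p - h p" "restrict_space lborel half_plane" "\<lambda>n p. \<psi> n p - k p" a b] h1 k1
      by (simp add: set_nn_integral_eq_restrict_space measurable_restrict_space1)
  qed
  moreover have "(\<lambda>n. \<integral>\<^sup>+\<omega>. ennreal ((white_noise (\<lambda>p. a * \<phi> n p + b * \<psi> n p) \<omega> - (a * X \<omega> + b * Y \<omega>))\<^sup>2) \<partial>P) \<longlonglongrightarrow> 0"
  proof -
    have "(\<integral>\<^sup>+\<omega>. ennreal ((white_noise (\<lambda>p. a * \<phi> n p + b * \<psi> n p) \<omega> - (a * X \<omega> + b * Y \<omega>))\<^sup>2) \<partial>P)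
      = (\<integral>\<^sup>+\<omega>. ennreal ((a * (white_noise (\<phi> n) \<omega> - X \<omega>) + b * (white_noise (\<psi> n) \<omega> - Y \<omega>))\<^sup>2) \<partial>P)" for n
      by (intro nn_integral_cong) (simp add: white_noise_lincomb[OF P \<phi> \<psi>] algebra_simps)
    then show ?thesis
      using nn_integral_sq_lincomb_tendsto_0[of "\<lambda>n \<omega>. white_noise (\<phi> n) \<omega> - X \<omega>" P "\<lambda>n \<omega>. white_noise (\<psi> n) \<omega> - Y \<omega>" a b] X Y
      by simp
  qed
  ultimately show ?thesis
    unfolding white_noise_pairing_def
    by (intro conjI exI[of _ "\<lambda>n p. a * \<phi> n p + b * \<psi> n p"] allI schwartz_functions_lincomb \<phi> \<psi>) measurable
qed

lemma white_noise_pairing_sum: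
  assumes P: "white_noise_space P" and "finite J" "J \<noteq> {}"
    and h: "\<And>j. j \<in> J \<Longrightarrow> white_noise_pairing P (h j) (X j)"
  shows "white_noise_pairing P (\<lambda>p. \<Sum>j\<in>J. a j * h j p) (\<lambda>\<omega>. \<Sum>j\<in>J. a j * X j \<omega>)"
  using assms(2,3,4)
proof (induction rule: finite_ne_induct)
  case (singleton j)
  then show ?case
    using white_noise_pairing_lincomb[OF P, of "h j" "X j" "h j" "X j" "a j" 0] by simp
next
  case (insert j J)
  then show ?case
    using white_noise_pairing_lincomb[OF P, of "h j" "X j" "\<lambda>p. \<Sum>j\<in>J. a j * h j p" "\<lambda>\<omega>. \<Sum>j\<in>J. a j * X j \<omega>" "a j" 1]
    by simp
qed

text \<open>The passage from nonnegative integrals to Bochner integrals: a convergent sequence of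
  nonnegative integrals may be infinite at first, hence \<open>eventually\<close>.\<close>

lemma L2_distance_tendsto_0:
  fixes f :: "nat \<Rightarrow> 'a \<Rightarrow> real"
  assumes [measurable]: "\<And>n. f n \<in> borel_measurable M" "h \<in> borel_measurable M"
    and lim: "(\<lambda>n. \<integral>\<^sup>+x. ennreal ((f n x - h x)\<^sup>2) \<partial>M) \<longlonglongrightarrow> 0"
  shows "\<forall>\<^sub>F n in sequentially. integrable M (\<lambda>x. (f n x - h x)\<^sup>2)"
    and "(\<lambda>n. \<integral>x. (f n x - h x)\<^sup>2 \<partial>M) \<longlonglongrightarrow> 0"
proof -
  have "\<forall>\<^sub>F n in sequentially. (\<integral>\<^sup>+x. ennreal ((f n x - h x)\<^sup>2) \<partial>M) < 1"
    using lim by (rule order_tendstoD) simp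
  then show "\<forall>\<^sub>F n in sequentially. integrable M (\<lambda>x. (f n x - h x)\<^sup>2)"
  proof eventually_elim
    case (elim n)
    then show ?case
      by (intro integrableI_nonneg) (simp_all add: order.strict_trans[OF _ ennreal_one_less_top])
  qed
  have "(\<lambda>n. enn2real (\<integral>\<^sup>+x. ennreal ((f n x - h x)\<^sup>2) \<partial>M)) \<longlonglongrightarrow> enn2real 0"
    using lim by (intro tendsto_enn2real) auto
  then show "(\<lambda>n. \<integral>x. (f n x - h x)\<^sup>2 \<partial>M) \<longlonglongrightarrow> 0"
    by (simp add: integral_eq_nn_integral)
qed

lemma L2_convergence_integral_sq:
  fixes f :: "nat \<Rightarrow> 'a \<Rightarrow> real"
  assumes [measurable]: "\<And>n. f n \<in> borel_measurable M" "h \<in> borel_measurable M"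
    and h: "integrable M (\<lambda>x. (h x)\<^sup>2)"
    and lim: "(\<lambda>n. \<integral>\<^sup>+x. ennreal ((f n x - h x)\<^sup>2) \<partial>M) \<longlonglongrightarrow> 0"
  shows "(\<lambda>n. \<integral>x. (f n x)\<^sup>2 \<partial>M) \<longlonglongrightarrow> (\<integral>x. (h x)\<^sup>2 \<partial>M)"
proof -
  define d where "d n = (\<integral>x. (f n x - h x)\<^sup>2 \<partial>M)" for n
  have int: "\<forall>\<^sub>F n in sequentially. integrable M (\<lambda>x. (f n x - h x)\<^sup>2)" and d0: "d \<longlonglongrightarrow> 0"
    unfolding d_def using L2_distance_tendsto_0[OF _ _ lim] by auto
  define H where "H = (\<integral>x. (h x)\<^sup>2 \<partial>M)"
  \<comment> \<open>Cauchy--Schwarz for the cross term, in the form of a weighted arithmetic-geometric mean inequality.\<close>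
  have bound: "\<forall>\<^sub>F n in sequentially. \<bar>(\<integral>x. (f n x)\<^sup>2 \<partial>M) - H\<bar> \<le> \<epsilon> * H + (1 + 1 / \<epsilon>) * d n" if \<epsilon>: "0 < \<epsilon>" for \<epsilon>
    using int
  proof eventually_elim
    case (elim n)
    have pt: "\<bar>(f n x)\<^sup>2 - (h x)\<^sup>2\<bar> \<le> \<epsilon> * (h x)\<^sup>2 + (1 + 1 / \<epsilon>) * (f n x - h x)\<^sup>2" for x
    proof -
      define u v where "u = h x" and "v = f n x - h x"
      have 1: "0 \<le> (\<epsilon> * u + v)\<^sup>2 / \<epsilon>" "0 \<le> (\<epsilon> * u - v)\<^sup>2 / \<epsilon>" using \<epsilon> by auto
      have 2: "(\<epsilon> * u + v)\<^sup>2 / \<epsilon> = \<epsilon> * u\<^sup>2 + 2 * u * v + v\<^sup>2 / \<epsilon>"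
          "(\<epsilon> * u - v)\<^sup>2 / \<epsilon> = \<epsilon> * u\<^sup>2 - 2 * u * v + v\<^sup>2 / \<epsilon>"
        using \<epsilon> by (simp_all add: power2_eq_square field_simps)
      have "(f n x)\<^sup>2 - (h x)\<^sup>2 = 2 * u * v + v\<^sup>2"
        unfolding u_def v_def by (simp add: power2_eq_square algebra_simps)
      moreover have "\<bar>2 * u * v + v\<^sup>2\<bar> \<le> \<epsilon> * u\<^sup>2 + (1 + 1 / \<epsilon>) * v\<^sup>2"
        unfolding distrib_right abs_le_iff using 1 zero_le_power2[of v] unfolding 2 by (simp del: zero_le_power2, linarith)
      ultimately show ?thesis unfolding u_def v_def by simp
    qed
    have rhs: "integrable M (\<lambda>x. \<epsilon> * (h x)\<^sup>2 + (1 + 1 / \<epsilon>) * (f n x - h x)\<^sup>2)"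
      using h elim by auto
    have diff: "integrable M (\<lambda>x. (f n x)\<^sup>2 - (h x)\<^sup>2)"
      by (rule Bochner_Integration.integrable_bound[OF rhs]) (measurable, use pt in \<open>auto intro!: AE_I2 order_trans[OF pt]\<close>)
    have "integrable M (\<lambda>x. ((f n x)\<^sup>2 - (h x)\<^sup>2) + (h x)\<^sup>2)"
      using diff h by (rule Bochner_Integration.integrable_add)
    then have fi: "integrable M (\<lambda>x. (f n x)\<^sup>2)" by simp
    have "\<bar>(\<integral>x. (f n x)\<^sup>2 \<partial>M) - H\<bar> = \<bar>\<integral>x. (f n x)\<^sup>2 - (h x)\<^sup>2 \<partial>M\<bar>"
      unfolding H_def using fi h by simp
    also have "\<dots> \<le> (\<integral>x. \<bar>(f n x)\<^sup>2 - (h x)\<^sup>2\<bar> \<partial>M)"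
      by (rule integral_abs_bound)
    also have "\<dots> \<le> (\<integral>x. \<epsilon> * (h x)\<^sup>2 + (1 + 1 / \<epsilon>) * (f n x - h x)\<^sup>2 \<partial>M)"
      using diff rhs pt by (intro integral_mono) auto
    also have "\<dots> = \<epsilon> * H + (1 + 1 / \<epsilon>) * d n"
      using h elim unfolding H_def d_def by (simp del: distrib_right)
    finally show ?case .
  qed
  have H0: "0 \<le> H" unfolding H_def by simp
  show ?thesis
    unfolding tendsto_iff dist_real_def H_def[symmetric]
  proof (intro allI impI)
    fix e :: real assume e: "0 < e"
    define \<epsilon> where "\<epsilon> = e / (2 * (H + 1))"
    have \<epsilon>: "0 < \<epsilon>" using e H0 unfolding \<epsilon>_def by simp
    have "\<epsilon> * H \<le> e / 2" using e H0 unfolding \<epsilon>_def by (simp add: field_simps)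
    have "(\<lambda>n. (1 + 1 / \<epsilon>) * d n) \<longlonglongrightarrow> (1 + 1 / \<epsilon>) * 0"
      by (intro tendsto_intros d0)
    then have "\<forall>\<^sub>F n in sequentially. (1 + 1 / \<epsilon>) * d n < e / 2"
      using e by (intro order_tendstoD(2)[where y = "(1 + 1 / \<epsilon>) * 0"]) auto
    with bound[OF \<epsilon>] show "\<forall>\<^sub>F n in sequentially. \<bar>(\<integral>x. (f n x)\<^sup>2 \<partial>M) - H\<bar> < e"
      by eventually_elim (use \<open>\<epsilon> * H \<le> e / 2\<close> in linarith)
  qed
qed

text \<open>Because \<open>x \<mapsto> exp (\<i> x)\<close> is 1-Lipschitz and \<open>z \<le> \<epsilon> + z\<^sup>2 / \<epsilon>\<close> for all \<open>z \<ge> 0\<close>, the difference of the two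
  integrals is at most \<open>\<epsilon>\<close> plus the squared distance divided by \<open>\<epsilon>\<close>.\<close>

lemma L2_convergence_char:
  fixes A :: "nat \<Rightarrow> 'a \<Rightarrow> real"
  assumes "prob_space M"
    and [measurable]: "\<And>n. A n \<in> borel_measurable M" "X \<in> borel_measurable M"
    and lim: "(\<lambda>n. \<integral>\<^sup>+x. ennreal ((A n x - X x)\<^sup>2) \<partial>M) \<longlonglongrightarrow> 0"
  shows "(\<lambda>n. \<integral>x. iexp (A n x) \<partial>M) \<longlonglongrightarrow> (\<integral>x. iexp (X x) \<partial>M)"
proof -
  interpret prob_space M by fact
  define d where "d n = (\<integral>x. (A n x - X x)\<^sup>2 \<partial>M)" for n
  have int: "\<forall>\<^sub>F n in sequentially. integrable M (\<lambda>x. (A n x - X x)\<^sup>2)" and d0: "d \<longlonglongrightarrow> 0"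
    unfolding d_def using L2_distance_tendsto_0[OF _ _ lim] by auto
  have lip: "cmod (iexp a - iexp b) \<le> \<bar>a - b\<bar>" for a b
  proof -
    have "iexp a - iexp b = iexp b * (iexp (a - b) - 1)"
      by (simp add: algebra_simps flip: exp_add)
    then have "cmod (iexp a - iexp b) = cmod (iexp (a - b) - 1)"
      by (simp only: norm_mult norm_exp_i_times mult_1)
    then show ?thesis using iexp_approx1[of "a - b" 0] by simp
  qed
  have bound: "\<forall>\<^sub>F n in sequentially. dist (\<integral>x. iexp (A n x) \<partial>M) (\<integral>x. iexp (X x) \<partial>M) \<le> \<epsilon> + d n / \<epsilon>" if \<epsilon>: "0 < \<epsilon>" for \<epsilon>
    using int
  proof eventually_elim
    case (elim n)
    have i: "integrable M (\<lambda>x. iexp (A n x))" "integrable M (\<lambda>x. iexp (X x))"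
      by (intro integrable_const_bound[where B = 1]; simp)+
    have pt: "cmod (iexp (A n x) - iexp (X x)) \<le> \<epsilon> + (A n x - X x)\<^sup>2 / \<epsilon>" for x
    proof -
      define z where "z = \<bar>A n x - X x\<bar>"
      have "z \<le> \<epsilon> + z\<^sup>2 / \<epsilon>"
      proof (cases "z \<le> \<epsilon>")
        case True then show ?thesis using \<epsilon> by (auto intro: order_trans)
      next
        case False
        then have "z \<le> z\<^sup>2 / \<epsilon>" using \<epsilon> by (simp add: field_simps power2_eq_square)
        then show ?thesis using \<epsilon> by linarith
      qed
      then show ?thesis using lip[of "A n x" "X x"] unfolding z_def by simp
    qed
    have "dist (\<integral>x. iexp (A n x) \<partial>M) (\<integral>x. iexp (X x) \<partial>M) = cmod (\<integral>x. iexp (A n x) - iexp (X x) \<partial>M)"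
      using i by (simp add: dist_norm)
    also have "\<dots> \<le> (\<integral>x. cmod (iexp (A n x) - iexp (X x)) \<partial>M)" by (rule integral_norm_bound)
    also have "\<dots> \<le> (\<integral>x. \<epsilon> + (A n x - X x)\<^sup>2 / \<epsilon> \<partial>M)"
      using i elim pt by (intro integral_mono) auto
    also have "\<dots> = \<epsilon> + d n / \<epsilon>" using elim unfolding d_def by (simp add: prob_space)
    finally show ?case .
  qed
  show ?thesis
    unfolding tendsto_iff
  proof (intro allI impI)
    fix e :: real assume e: "0 < e"
    have "(\<lambda>n. d n / (e / 2)) \<longlonglongrightarrow> 0 / (e / 2)"
      using e by (intro tendsto_intros d0) auto
    then have "\<forall>\<^sub>F n in sequentially. d n / (e / 2) < e / 2"
      using e by (intro order_tendstoD(2)[where y = "0 / (e / 2)"]) auto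
    moreover have "0 < e / 2" using e by simp
    note bound[OF this]
    ultimately show "\<forall>\<^sub>F n in sequentially. dist (\<integral>x. iexp (A n x) \<partial>M) (\<integral>x. iexp (X x) \<partial>M) < e"
      by eventually_elim linarith
  qed
qed

text \<open>Both sides of the defining identity of white noise are continuous for \<open>L\<^sup>2\<close> convergence, so it
  passes from Schwartz functions to the extension.\<close>

lemma char_white_noise_pairing:
  assumes P: "white_noise_space P" and h: "white_noise_pairing P h X"
  shows "(\<integral>\<omega>. iexp (X \<omega>) \<partial>P) = of_real (exp (- (LINT p:half_plane|lborel. (h p)\<^sup>2) / 2))"
proof -
  obtain \<phi> where \<phi>: "\<And>n. \<phi> n \<in> schwartz_functions"
      and h1: "(\<lambda>n. \<integral>\<^sup>+p\<in>half_plane. ennreal ((\<phi> n p - h p)\<^sup>2) \<partial>lborel) \<longlonglongrightarrow> 0"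
      and X: "(\<lambda>n. \<integral>\<^sup>+\<omega>. ennreal ((white_noise (\<phi> n) \<omega> - X \<omega>)\<^sup>2) \<partial>P) \<longlonglongrightarrow> 0"
    using h by (rule white_noise_pairingE) (rule that)
  have [measurable]: "h \<in> borel_measurable lborel" "X \<in> borel_measurable P"
    and hsq: "integrable lborel (\<lambda>p. (h p)\<^sup>2)"
    using h unfolding white_noise_pairing_def by auto
  note [measurable] = white_noise_measurable[OF P \<phi>] schwartz_functions_borel_measurable[OF \<phi>]
  have hp: "half_plane \<in> sets lborel" by simp
  have "(\<lambda>n. \<integral>p. (\<phi> n p)\<^sup>2 \<partial>restrict_space lborel half_plane) \<longlonglongrightarrow> (\<integral>p. (h p)\<^sup>2 \<partial>restrict_space lborel half_plane)"
  proof (rule L2_convergence_integral_sq)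
    show "integrable (restrict_space lborel half_plane) (\<lambda>p. (h p)\<^sup>2)"
      using integrable_mult_indicator[OF hp hsq] hp by (simp add: integrable_restrict_space)
    show "(\<lambda>n. \<integral>\<^sup>+p. ennreal ((\<phi> n p - h p)\<^sup>2) \<partial>restrict_space lborel half_plane) \<longlonglongrightarrow> 0"
      using h1 hp by (simp add: set_nn_integral_eq_restrict_space)
  qed (simp_all add: measurable_restrict_space1)
  then have "(\<lambda>n. LINT p:half_plane|lborel. (\<phi> n p)\<^sup>2) \<longlonglongrightarrow> (LINT p:half_plane|lborel. (h p)\<^sup>2)"
    using hp by (simp add: integral_restrict_space set_lebesgue_integral_def)
  then have "(\<lambda>n. of_real (exp (- (LINT p:half_plane|lborel. (\<phi> n p)\<^sup>2) / 2)) :: complex)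
     \<longlonglongrightarrow> of_real (exp (- (LINT p:half_plane|lborel. (h p)\<^sup>2) / 2))"
    by (intro tendsto_intros) auto
  moreover have "(\<lambda>n. \<integral>\<omega>. iexp (white_noise (\<phi> n) \<omega>) \<partial>P) \<longlonglongrightarrow> (\<integral>\<omega>. iexp (X \<omega>) \<partial>P)"
    by (rule L2_convergence_char[OF prob_space_white_noise[OF P] _ _ X]) measurable
  ultimately show ?thesis
    unfolding char_white_noise[OF P \<phi>] using LIMSEQ_unique by blast
qed

section \<open>The triangle kernels\<close>

lemma backward_triangle_closed: "closed (backward_triangle x t c)"
proof -
  have "backward_triangle x t c = {p. 0 \<le> snd p \<and> snd p \<le> t \<and> \<bar>fst p - x\<bar> \<le> c * (t - snd p)}"
    unfolding backward_triangle_def by auto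
  also have "closed \<dots>"
    by (intro closed_Collect_conj closed_Collect_le continuous_intros)
  finally show ?thesis .
qed

text \<open>By Cavalieri's principle: the slice at height \<open>s\<close> is an interval of length \<open>2 c (t - s)\<close>.\<close>

lemma emeasure_backward_triangle:
  assumes t: "0 \<le> t" and c: "0 \<le> c"
  shows "emeasure lborel (backward_triangle x t c) = ennreal (c * t\<^sup>2)"
proof -
  have [measurable]: "backward_triangle x t c \<in> sets (lborel \<Otimes>\<^sub>M lborel)"
    using backward_triangle_closed[of x t c] unfolding lborel_prod by simp
  have slice: "(\<lambda>y. (y, s)) -` backward_triangle x t c = (if s \<in> {0..t} then {x - c * (t - s)..x + c * (t - s)} else {})" for s
    unfolding backward_triangle_def by (auto simp: abs_le_iff)
  have "emeasure (lborel \<Otimes>\<^sub>M lborel) (backward_triangle x t c)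
     = (\<integral>\<^sup>+s. emeasure lborel ((\<lambda>y. (y, s)) -` backward_triangle x t c) \<partial>lborel)"
    by (rule lborel_pair.emeasure_pair_measure_alt2) measurable
  also have "\<dots> = (\<integral>\<^sup>+s. ennreal (2 * c * (t - s)) * indicator {0..t} s \<partial>lborel)"
    using c by (intro nn_integral_cong) (auto simp: slice)
  also have "\<dots> = ennreal (0 - - (c * t\<^sup>2))"
  proof -
    have "s * c \<le> c * t" if "s \<le> t" for s
      using mult_right_mono[OF that c] by (simp add: mult.commute)
    then show ?thesis
    using t c
    by (intro nn_integral_FTC_Icc[where F = "\<lambda>s. - (c * (t - s)\<^sup>2)", THEN trans])
      (auto intro!: derivative_eq_intros simp: algebra_simps)
  qed
  finally show ?thesis by (simp add: lborel_prod)
qed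

lemma backward_triangle_Int:
  assumes "0 \<le> c" "c \<le> d"
  shows "backward_triangle x t c \<inter> backward_triangle x t d = backward_triangle x t c"
proof -
  have "c * (t - s) \<le> d * (t - s)" if "s \<le> t" for s
    using assms that by (intro mult_right_mono) auto
  then show ?thesis unfolding backward_triangle_def by fastforce
qed

text \<open>Triangles with the same vertex are nested, so the product of two indicator functions is the
  indicator function of the one with the smaller speed.\<close>

lemma integral_backward_triangle_product:
  assumes "0 \<le> t" "0 \<le> c" "0 \<le> d"
  shows "integrable lborel (\<lambda>p. indicator (backward_triangle x t c) p * indicator (backward_triangle x t d) p :: real)"
    and "(\<integral>p. indicator (backward_triangle x t c) p * indicator (backward_triangle x t d) p \<partial>lborel) = min c d * t\<^sup>2"
proof -
  have *: "backward_triangle x t c \<inter> backward_triangle x t d = backward_triangle x t (min c d)"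
    using assms backward_triangle_Int[of c d x t] backward_triangle_Int[of d c x t]
    by (cases "c \<le> d") (auto simp: min_def Int_commute)
  have **: "indicator (backward_triangle x t c) p * indicator (backward_triangle x t d) p = (indicator (backward_triangle x t (min c d)) p :: real)" for p
    unfolding *[symmetric] by (simp add: indicator_inter_arith)
  have e: "emeasure lborel (backward_triangle x t (min c d)) = ennreal (min c d * t\<^sup>2)"
    using assms by (intro emeasure_backward_triangle) auto
  have s: "backward_triangle x t (min c d) \<in> sets lborel"
    using backward_triangle_closed by simp
  show "integrable lborel (\<lambda>p. indicator (backward_triangle x t c) p * indicator (backward_triangle x t d) p :: real)"
    unfolding ** using s e by (intro integrable_real_indicator) auto
  show "(\<integral>p. indicator (backward_triangle x t c) p * indicator (backward_triangle x t d) p \<partial>lborel) = min c d * t\<^sup>2"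
    unfolding ** using s e assms by (simp add: measure_def)
qed

text \<open>The source of the Brownian motion.  As triangles with a common vertex are nested, the
  inner product of the kernels for the speeds \<open>c\<close> and \<open>d\<close> is
  \<open>1 / (4 c d) * min c d * t\<^sup>2\<close>, that is \<open>t\<^sup>2 / 4 * min (1 / c) (1 / d)\<close>: in the variable \<open>r = 1 / c\<close>,
  and after multiplication by \<open>2 / t\<close>, this is the covariance of Brownian motion.\<close>

lemma char_rescaled_solution:
  fixes r \<theta> :: "nat \<Rightarrow> real"
  assumes P: "white_noise_space P" and u: "\<And>c. 0 < c \<Longrightarrow> random_field_solution P c (u c)"
    and t: "0 < t" and r: "\<And>j. 0 < r j" and n: "0 < n"
  shows "(\<integral>\<omega>. iexp (\<Sum>j<n. \<theta> j * (2 / t * u (1 / r j) x t \<omega>)) \<partial>P)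
      = of_real (exp (- (\<Sum>i<n. \<Sum>j<n. \<theta> i * \<theta> j * min (r i) (r j)) / 2))"
proof -
  define tri where "tri j = (indicator (backward_triangle x t (1 / r j)) :: real \<times> real \<Rightarrow> real)" for j
  have "white_noise_pairing P (\<lambda>p. 1 / (2 * (1 / r j)) * tri j p) (u (1 / r j) x t)" for j
    using u[of "1 / r j"] r[of j] t unfolding random_field_solution_def tri_def by simp
  then have "white_noise_pairing P (\<lambda>p. \<Sum>j<n. \<theta> j * (2 / t) * (1 / (2 * (1 / r j)) * tri j p)) (\<lambda>\<omega>. \<Sum>j<n. \<theta> j * (2 / t) * u (1 / r j) x t \<omega>)"
    using n by (intro white_noise_pairing_sum[OF P]) auto
  then have wp: "white_noise_pairing P (\<lambda>p. \<Sum>j<n. \<theta> j * r j / t * tri j p) (\<lambda>\<omega>. \<Sum>j<n. \<theta> j * (2 / t * u (1 / r j) x t \<omega>))"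
    by (simp add: mult.assoc)
  have support: "p \<in> half_plane" if "tri j p \<noteq> 0" for j p
    using that by (auto simp: tri_def indicator_def backward_triangle_def half_plane_def split: if_splits)
  have prod: "integrable lborel (\<lambda>p. tri i p * tri j p)"
    "(\<integral>p. tri i p * tri j p \<partial>lborel) = min (1 / r i) (1 / r j) * t\<^sup>2" for i j
    unfolding tri_def using r[of i] r[of j] t by (intro integral_backward_triangle_product; simp)+
  have "(LINT p:half_plane|lborel. (\<Sum>j<n. \<theta> j * r j / t * tri j p)\<^sup>2)
     = (\<integral>p. (\<Sum>i<n. \<Sum>j<n. (\<theta> i * r i / t) * (\<theta> j * r j / t) * (tri i p * tri j p)) \<partial>lborel)"
    unfolding set_lebesgue_integral_def
  proof (intro Bochner_Integration.integral_cong refl)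
    fix p
    have "(\<Sum>j<n. \<theta> j * r j / t * tri j p) = 0" if "p \<notin> half_plane"
      using support[of _ p] that by (intro sum.neutral) auto
    then have "indicat_real half_plane p *\<^sub>R (\<Sum>j<n. \<theta> j * r j / t * tri j p)\<^sup>2 = (\<Sum>j<n. \<theta> j * r j / t * tri j p)\<^sup>2"
      by (auto simp: indicator_def)
    then show "indicat_real half_plane p *\<^sub>R (\<Sum>j<n. \<theta> j * r j / t * tri j p)\<^sup>2
       = (\<Sum>i<n. \<Sum>j<n. (\<theta> i * r i / t) * (\<theta> j * r j / t) * (tri i p * tri j p))"
      unfolding power2_eq_square sum_product by (simp add: mult_ac)
  qed
  also have "\<dots> = (\<Sum>i<n. \<Sum>j<n. (\<theta> i * r i / t) * (\<theta> j * r j / t) * (min (1 / r i) (1 / r j) * t\<^sup>2))"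
    using prod by (simp only: Bochner_Integration.integral_sum Bochner_Integration.integrable_sum
      Bochner_Integration.integrable_mult_right integral_mult_right_zero)
  also have "\<dots> = (\<Sum>i<n. \<Sum>j<n. \<theta> i * \<theta> j * min (r i) (r j))"
  proof (intro sum.cong refl)
    fix i j
    have "r i * r j * min (1 / r i) (1 / r j) = min (r i) (r j)"
      using r[of i] r[of j] by (auto simp: min_def field_simps)
    then have "\<theta> i * \<theta> j * min (r i) (r j) = \<theta> i * \<theta> j * (r i * r j * min (1 / r i) (1 / r j))" by simp
    then show "(\<theta> i * r i / t) * (\<theta> j * r j / t) * (min (1 / r i) (1 / r j) * t\<^sup>2) = \<theta> i * \<theta> j * min (r i) (r j)"
      using t by (auto simp add: power2_eq_square mult.assoc)
  qed
  finally show ?thesis unfolding char_white_noise_pairing[OF P wp] by simp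
qed

section \<open>Brownian motion with a normal start\<close>

lemma sum_telescope_indicator:
  fixes c :: "nat \<Rightarrow> real"
  assumes "j \<le> n"
  shows "(\<Sum>m<n. (if m < j then 1 else 0) * (c (Suc m) - c m)) = c j - c 0"
proof -
  have "(\<Sum>m<n. (if m < j then 1 else 0) * (c (Suc m) - c m)) = (\<Sum>m<j. c (Suc m) - c m)"
    using assms by (intro sum.mono_neutral_cong_right) auto
  then show ?thesis by (simp add: sum_lessThan_telescope)
qed

text \<open>A linear combination of values of a path that starts in 0, rewritten as a linear combination of
  increments; the coefficients become tail sums.\<close>

lemma abel_summation_tails:
  fixes c \<theta> :: "nat \<Rightarrow> real"
  assumes "c 0 = 0"
  shows "(\<Sum>j<n. \<theta> j * c j) = (\<Sum>m<n. (\<Sum>j=Suc m..<n. \<theta> j) * (c (Suc m) - c m))"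
proof -
  have tail: "(\<Sum>j=Suc m..<n. \<theta> j) = (\<Sum>j<n. \<theta> j * (if m < j then 1 else 0))" for m
    by (intro sum.mono_neutral_cong_left) auto
  have "(\<Sum>j<n. \<theta> j * c j) = (\<Sum>j<n. \<theta> j * (\<Sum>m<n. (if m < j then 1 else 0) * (c (Suc m) - c m)))"
    using assms by (intro sum.cong refl) (simp add: sum_telescope_indicator)
  also have "\<dots> = (\<Sum>m<n. \<Sum>j<n. \<theta> j * ((if m < j then 1 else 0) * (c (Suc m) - c m)))"
    unfolding sum_distrib_left by (rule sum.swap)
  also have "\<dots> = (\<Sum>m<n. (\<Sum>j<n. \<theta> j * (if m < j then 1 else 0)) * (c (Suc m) - c m))"
    by (simp only: sum_distrib_right mult.assoc)
  finally show ?thesis unfolding tail .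
qed

text \<open>The covariance \<open>min s s'\<close> of Brownian motion, expanded along the grid: \<open>min (T i) (T j)\<close> is the
  sum of the increments of \<open>T\<close> that precede both \<open>i\<close> and \<open>j\<close>.\<close>

lemma min_quadratic_form:
  fixes T \<theta> :: "nat \<Rightarrow> real"
  assumes "incseq T" "T 0 = 0"
  shows "(\<Sum>i<n. \<Sum>j<n. \<theta> i * \<theta> j * min (T i) (T j)) = (\<Sum>m<n. (\<Sum>j=Suc m..<n. \<theta> j)\<^sup>2 * (T (Suc m) - T m))"
proof -
  have tail: "(\<Sum>j=Suc m..<n. \<theta> j) = (\<Sum>j<n. \<theta> j * (if m < j then 1 else 0))" for m
    by (intro sum.mono_neutral_cong_left) auto
  have mn: "min (T i) (T j) = (\<Sum>m<n. (if m < i then 1 else 0) * (if m < j then 1 else 0) * (T (Suc m) - T m))"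
    if "i < n" "j < n" for i j
  proof -
    have "min (T i) (T j) = T (min i j)" using assms(1) by (simp add: min_of_mono incseq_def mono_def)
    also have "\<dots> = (\<Sum>m<n. (if m < min i j then 1 else 0) * (T (Suc m) - T m))"
      using sum_telescope_indicator[of "min i j" n T] that assms(2) by linarith
    also have "\<dots> = (\<Sum>m<n. (if m < i then 1 else 0) * (if m < j then 1 else 0) * (T (Suc m) - T m))"
      by (intro sum.cong) auto
    finally show ?thesis .
  qed
  have "(\<Sum>i<n. \<Sum>j<n. \<theta> i * \<theta> j * min (T i) (T j))
     = (\<Sum>i<n. \<Sum>j<n. \<Sum>m<n. (\<theta> i * (if m < i then 1 else 0)) * (\<theta> j * (if m < j then 1 else 0)) * (T (Suc m) - T m))"
    by (intro sum.cong refl) (simp add: mn sum_distrib_left mult_ac)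
  also have "\<dots> = (\<Sum>i<n. \<Sum>m<n. \<Sum>j<n. (\<theta> i * (if m < i then 1 else 0)) * (\<theta> j * (if m < j then 1 else 0)) * (T (Suc m) - T m))"
    by (rule sum.cong[OF refl]) (rule sum.swap)
  also have "\<dots> = (\<Sum>m<n. \<Sum>i<n. \<Sum>j<n. (\<theta> i * (if m < i then 1 else 0)) * (\<theta> j * (if m < j then 1 else 0)) * (T (Suc m) - T m))"
    by (rule sum.swap)
  also have "\<dots> = (\<Sum>m<n. (\<Sum>j=Suc m..<n. \<theta> j)\<^sup>2 * (T (Suc m) - T m))"
    unfolding tail power2_eq_square sum_product by (simp only: sum_distrib_right)
  finally show ?thesis .
qed

lemma char_centered_normal:
  assumes "prob_space M" and X: "distributed M lborel X (normal_density 0 \<sigma>)" and \<sigma>: "0 < \<sigma>"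
  shows "(\<integral>\<omega>. iexp (\<theta> * X \<omega>) \<partial>M) = of_real (exp (- (\<theta>\<^sup>2 * \<sigma>\<^sup>2) / 2))"
proof -
  interpret prob_space M by fact
  have "distributed M lborel (\<lambda>x. X x / \<sigma>) std_normal_density"
    using X normal_standard_normal_convert[OF \<sigma>, of X 0] by simp
  then have d: "distr M borel (\<lambda>x. X x / \<sigma>) = std_normal_distribution"
    and [measurable]: "(\<lambda>x. X x / \<sigma>) \<in> borel_measurable M"
    by (auto simp: distributed_def cong: distr_cong)
  have "(\<integral>\<omega>. iexp (\<theta> * X \<omega>) \<partial>M) = (\<integral>\<omega>. iexp ((\<theta> * \<sigma>) * (X \<omega> / \<sigma>)) \<partial>M)"
    using \<sigma> by simp
  also have "\<dots> = char (distr M borel (\<lambda>x. X x / \<sigma>)) (\<theta> * \<sigma>)"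
    unfolding char_def by (subst integral_distr) auto
  also have "\<dots> = of_real (exp (- (\<theta>\<^sup>2 * \<sigma>\<^sup>2) / 2))"
    unfolding d char_std_normal_distribution by (simp add: power_mult_distrib)
  finally show ?thesis .
qed

lemma brownian_measurable: "standard_brownian_motion M w \<Longrightarrow> 0 \<le> s \<Longrightarrow> w s \<in> borel_measurable M"
  unfolding standard_brownian_motion_def by blast

text \<open>The case \<open>r = s\<close> is included: the increment is then 0, although it has no density.\<close>

lemma brownian_increment_char:
  assumes w: "standard_brownian_motion M w" and "0 \<le> r" "r \<le> s"
  shows "(\<integral>\<omega>. iexp (\<theta> * (w s \<omega> - w r \<omega>)) \<partial>M) = of_real (exp (- (\<theta>\<^sup>2 * (s - r)) / 2))"
proof (cases "r < s")
  case True
  then have "distributed M lborel (\<lambda>\<omega>. w s \<omega> - w r \<omega>) (normal_density 0 (sqrt (s - r)))"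
    using w \<open>0 \<le> r\<close> unfolding standard_brownian_motion_def by blast
  from char_centered_normal[OF _ this] True w show ?thesis
    unfolding standard_brownian_motion_def by simp
next
  case False
  interpret prob_space M using w unfolding standard_brownian_motion_def by blast
  from False \<open>r \<le> s\<close> show ?thesis by (simp add: prob_space)
qed

lemma brownian_char:
  assumes w: "standard_brownian_motion M w" and T: "incseq T" "T 0 = 0"
  shows "(\<integral>\<omega>. iexp (\<Sum>j<n. \<theta> j * w (T j) \<omega>) \<partial>M)
     = of_real (exp (- (\<Sum>i<n. \<Sum>j<n. \<theta> i * \<theta> j * min (T i) (T j)) / 2))"
proof -
  interpret prob_space M using w unfolding standard_brownian_motion_def by blast
  define \<Theta> where "\<Theta> m = (\<Sum>j=Suc m..<n. \<theta> j)" for m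
  have T0: "0 \<le> T m" for m using T incseqD[of T 0 m] by simp
  have [measurable]: "w (T m) \<in> borel_measurable M" for m by (rule brownian_measurable[OF w T0])
  have "indep_vars (\<lambda>_. borel) (\<lambda>i \<omega>. w (T (Suc i)) \<omega> - w (T i) \<omega>) {..<n}"
    using w T unfolding standard_brownian_motion_def by simp
  then have indep: "indep_vars (\<lambda>_. borel) (\<lambda>i \<omega>. \<Theta> i * (w (T (Suc i)) \<omega> - w (T i) \<omega>)) {..<n}"
    by (rule indep_vars_compose2) measurable
  have "(\<integral>\<omega>. iexp (\<Sum>j<n. \<theta> j * w (T j) \<omega>) \<partial>M) = (\<integral>\<omega>. iexp (\<Sum>m<n. \<Theta> m * (w (T (Suc m)) \<omega> - w (T m) \<omega>)) \<partial>M)"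
  proof (intro Bochner_Integration.integral_cong refl)
    fix \<omega> assume "\<omega> \<in> space M"
    then have "w (T 0) \<omega> = 0" using w T unfolding standard_brownian_motion_def by simp
    from abel_summation_tails[where c = "\<lambda>j. w (T j) \<omega>", OF this]
    show "iexp (\<Sum>j<n. \<theta> j * w (T j) \<omega>) = iexp (\<Sum>m<n. \<Theta> m * (w (T (Suc m)) \<omega> - w (T m) \<omega>))"
      unfolding \<Theta>_def by simp
  qed
  also have "\<dots> = char (distr M borel (\<lambda>\<omega>. \<Sum>m<n. \<Theta> m * (w (T (Suc m)) \<omega> - w (T m) \<omega>))) 1"
    unfolding char_def by (subst integral_distr) auto
  also have "\<dots> = (\<Prod>m<n. char (distr M borel (\<lambda>\<omega>. \<Theta> m * (w (T (Suc m)) \<omega> - w (T m) \<omega>))) 1)"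
    by (rule char_distr_sum[OF indep])
  also have "\<dots> = (\<Prod>m<n. of_real (exp (- ((\<Theta> m)\<^sup>2 * (T (Suc m) - T m)) / 2)))"
  proof (intro prod.cong refl)
    fix m
    have "char (distr M borel (\<lambda>\<omega>. \<Theta> m * (w (T (Suc m)) \<omega> - w (T m) \<omega>))) 1
       = (\<integral>\<omega>. iexp (\<Theta> m * (w (T (Suc m)) \<omega> - w (T m) \<omega>)) \<partial>M)"
      unfolding char_def by (subst integral_distr) auto
    also have "\<dots> = of_real (exp (- ((\<Theta> m)\<^sup>2 * (T (Suc m) - T m)) / 2))"
      by (rule brownian_increment_char[OF w T0 incseq_SucD[OF T(1)]])
    finally show "char (distr M borel (\<lambda>\<omega>. \<Theta> m * (w (T (Suc m)) \<omega> - w (T m) \<omega>))) 1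
       = of_real (exp (- ((\<Theta> m)\<^sup>2 * (T (Suc m) - T m)) / 2))" .
  qed
  also have "\<dots> = of_real (exp (- (\<Sum>m<n. (\<Theta> m)\<^sup>2 * (T (Suc m) - T m)) / 2))"
    by (simp add: exp_sum sum_negf[symmetric] sum_divide_distrib)
  also have "(\<Sum>m<n. (\<Theta> m)\<^sup>2 * (T (Suc m) - T m)) = (\<Sum>i<n. \<Sum>j<n. \<theta> i * \<theta> j * min (T i) (T j))"
    unfolding \<Theta>_def by (rule min_quadratic_form[OF T, symmetric])
  finally show ?thesis .
qed

text \<open>A Brownian motion with an independent start of variance \<open>v\<close> has the covariance of a Brownian
  motion observed from time \<open>v\<close> onwards.\<close>

lemma char_shifted_start:
  assumes w: "standard_brownian_motion M w" and T: "incseq T" "T 0 = 0" and v: "0 < v"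
  shows "(\<integral>z. iexp (\<Sum>j<n. \<theta> j * (fst z + w (T j) (snd z))) \<partial>(density lborel (normal_density 0 (sqrt v)) \<Otimes>\<^sub>M M))
     = of_real (exp (- (\<Sum>i<n. \<Sum>j<n. \<theta> i * \<theta> j * min (v + T i) (v + T j)) / 2))"
proof -
  define G where "G = density lborel (normal_density 0 (sqrt v))"
  interpret M: prob_space M using w unfolding standard_brownian_motion_def by blast
  interpret G: prob_space G unfolding G_def using v by (intro prob_space_normal_density) simp
  interpret GM: pair_prob_space G M ..
  have [measurable_cong]: "sets G = sets borel" unfolding G_def by simp
  have T0: "0 \<le> T m" for m using T incseqD[of T 0 m] by simp
  have [measurable]: "w (T m) \<in> borel_measurable M" for m by (rule brownian_measurable[OF w T0])
  have int: "integrable (G \<Otimes>\<^sub>M M) (\<lambda>z. iexp (\<Sum>j<n. \<theta> j * (fst z + w (T j) (snd z))))"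
    by (rule GM.P.integrable_const_bound[where B = 1]) (auto simp del: of_real_sum)
  have start: "(\<integral>y. iexp (s * y) \<partial>G) = of_real (exp (- (s\<^sup>2 * v) / 2))" for s
  proof -
    have "distributed G lborel (\<lambda>y. y) (normal_density 0 (sqrt v))"
      unfolding distributed_def G_def by (auto intro!: measure_eqI simp: emeasure_distr)
    from char_centered_normal[OF G.prob_space_axioms this] v show ?thesis by simp
  qed
  have "(\<integral>z. iexp (\<Sum>j<n. \<theta> j * (fst z + w (T j) (snd z))) \<partial>(G \<Otimes>\<^sub>M M))
     = (\<integral>y. (\<integral>\<omega>. iexp (\<Sum>j<n. \<theta> j * (y + w (T j) \<omega>)) \<partial>M) \<partial>G)"
    using GM.integral_fst'[OF int] by simp
  also have "\<dots> = (\<integral>y. (\<integral>\<omega>. iexp ((\<Sum>j<n. \<theta> j) * y) * iexp (\<Sum>j<n. \<theta> j * w (T j) \<omega>) \<partial>M) \<partial>G)"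
    by (simp add: distrib_left sum.distrib sum_distrib_right exp_add)
  also have "\<dots> = (\<integral>y. iexp ((\<Sum>j<n. \<theta> j) * y) \<partial>G) * (\<integral>\<omega>. iexp (\<Sum>j<n. \<theta> j * w (T j) \<omega>) \<partial>M)"
    by (simp only: integral_mult_right_zero integral_mult_left_zero)
  also have "\<dots> = of_real (exp (- ((\<Sum>j<n. \<theta> j)\<^sup>2 * v + (\<Sum>i<n. \<Sum>j<n. \<theta> i * \<theta> j * min (T i) (T j))) / 2))"
    unfolding start brownian_char[OF w T] of_real_mult[symmetric] exp_add[symmetric]
    by (simp add: field_simps)
  also have "(\<Sum>j<n. \<theta> j)\<^sup>2 * v + (\<Sum>i<n. \<Sum>j<n. \<theta> i * \<theta> j * min (T i) (T j))
     = (\<Sum>i<n. \<Sum>j<n. \<theta> i * \<theta> j * min (v + T i) (v + T j))"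
  proof -
    have "min (v + a) (v + b) = v + min a b" for a b :: real by (simp add: min_def)
    then show ?thesis
      unfolding power2_eq_square sum_product by (simp add: distrib_left sum.distrib sum_distrib_right)
  qed
  finally show ?thesis unfolding G_def .
qed

section \<open>Staying in an open interval\<close>

text \<open>Staying in an open interval at all points of a dense set does not prevent a continuous path
  from touching the boundary in between.  Hence a margin \<open>1 / (k + 1)\<close> is kept at all dyadic grid
  points, with the same \<open>k\<close> for all of them.\<close>

definition stays_on_grids :: "real \<Rightarrow> real \<Rightarrow> real \<Rightarrow> (real \<Rightarrow> real) \<Rightarrow> bool" where
  "stays_on_grids S a b f \<longleftrightarrow>
     (\<exists>k. \<forall>n. \<forall>j<Suc (2 ^ n). f (S * real j / 2 ^ n) \<in> {a + 1 / real (Suc k)..b - 1 / real (Suc k)})"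

lemma grid_point_in_interval: "0 \<le> S \<Longrightarrow> j < Suc (2 ^ n) \<Longrightarrow> S * real j / 2 ^ n \<in> {0..S}"
proof -
  assume "0 \<le> S" "j < Suc (2 ^ n)"
  moreover from this have "real j \<le> 2 ^ n" by (metis less_Suc_eq_le of_nat_le_iff of_nat_numeral of_nat_power)
  ultimately show ?thesis using mult_left_mono[of "real j" "2 ^ n" S] by (simp add: field_simps)
qed

text \<open>A margin at all grid points passes to the limit along grid points approaching \<open>s\<close>;
  conversely, a continuous path attains its extrema on the compact time interval, which gives a
  margin.\<close>

lemma stays_on_grids_iff:
  assumes S: "0 < S" and f: "continuous_on {0..S} f"
  shows "stays_on_grids S a b f \<longleftrightarrow> (\<forall>s\<in>{0..S}. f s \<in> {a<..<b})"
proof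
  assume "stays_on_grids S a b f"
  then obtain k where k: "\<And>n j. j < Suc (2 ^ n) \<Longrightarrow> f (S * real j / 2 ^ n) \<in> {a + 1 / real (Suc k)..b - 1 / real (Suc k)}"
    unfolding stays_on_grids_def by blast
  show "\<forall>s\<in>{0..S}. f s \<in> {a<..<b}"
  proof
    fix s assume s: "s \<in> {0..S}"
    define j where "j n = nat \<lfloor>s / S * 2 ^ n\<rfloor>" for n :: nat
    have r: "0 \<le> s / S" "s / S \<le> 1" using s S by auto
    have j: "real (j n) = of_int \<lfloor>s / S * 2 ^ n\<rfloor>" for n
      unfolding j_def using r mult_nonneg_nonneg[OF r(1), of "2 ^ n"] by (subst of_nat_nat) auto
    have jn: "j n < Suc (2 ^ n)" for n
    proof -
      have "real (j n) \<le> s / S * 2 ^ n" unfolding j by (rule of_int_floor_le)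
      also have "\<dots> \<le> 1 * 2 ^ n" using r by (intro mult_right_mono) auto
      finally have "real (j n) \<le> real (2 ^ n)" by simp
      then show ?thesis by linarith
    qed
    have "(\<lambda>n. S * real (j n) / 2 ^ n) \<longlonglongrightarrow> s"
    proof (rule real_tendsto_sandwich)
      show "(\<lambda>n. s - S * (1 / 2) ^ n) \<longlonglongrightarrow> s"
        by (auto intro!: tendsto_eq_intros LIMSEQ_power_zero)
      show "\<forall>\<^sub>F n in sequentially. s - S * (1 / 2) ^ n \<le> S * real (j n) / 2 ^ n"
      proof (rule always_eventually, rule allI)
        fix n
        have "s / S * 2 ^ n - 1 \<le> real (j n)" unfolding j by linarith
        then have "S * (s / S * 2 ^ n - 1) / 2 ^ n \<le> S * real (j n) / 2 ^ n"
          using S by (intro divide_right_mono mult_left_mono) auto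
        then show "s - S * (1 / 2) ^ n \<le> S * real (j n) / 2 ^ n"
          using S by (simp add: right_diff_distrib diff_divide_distrib power_one_over)
      qed
      show "\<forall>\<^sub>F n in sequentially. S * real (j n) / 2 ^ n \<le> s"
      proof (rule always_eventually, rule allI)
        fix n
        have "real (j n) \<le> s / S * 2 ^ n" unfolding j by (rule of_int_floor_le)
        then have "S * real (j n) / 2 ^ n \<le> S * (s / S * 2 ^ n) / 2 ^ n"
          using S by (intro divide_right_mono mult_left_mono) auto
        then show "S * real (j n) / 2 ^ n \<le> s" using S by simp
      qed
    qed simp
    then have "(\<lambda>n. f (S * real (j n) / 2 ^ n)) \<longlonglongrightarrow> f s"
      using grid_point_in_interval[OF less_imp_le[OF S] jn] s
      by (intro continuous_on_tendsto_compose[OF f]) auto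
    then have "f s \<in> {a + 1 / real (Suc k)..b - 1 / real (Suc k)}"
      by (rule closed_sequentially[OF closed_atLeastAtMost k[OF jn]])
    moreover have "0 < 1 / real (Suc k)" by simp
    ultimately show "f s \<in> {a<..<b}" unfolding atLeastAtMost_iff greaterThanLessThan_iff by linarith
  qed
next
  assume st: "\<forall>s\<in>{0..S}. f s \<in> {a<..<b}"
  obtain u where u: "u \<in> {0..S}" "\<And>s. s \<in> {0..S} \<Longrightarrow> f u \<le> f s"
    using continuous_attains_inf[OF compact_Icc _ f] S by auto
  obtain v where v: "v \<in> {0..S}" "\<And>s. s \<in> {0..S} \<Longrightarrow> f s \<le> f v"
    using continuous_attains_sup[OF compact_Icc _ f] S by auto
  have "0 < min (f u - a) (b - f v)" using st u(1) v(1) by auto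
  from reals_Archimedean[OF this] obtain k where k: "1 / real (Suc k) < min (f u - a) (b - f v)"
    unfolding inverse_eq_divide by blast
  have "f (S * real j / 2 ^ n) \<in> {a + 1 / real (Suc k)..b - 1 / real (Suc k)}" if "j < Suc (2 ^ n)" for n j
    using u(2)[OF grid_point_in_interval[OF less_imp_le[OF S] that]]
      v(2)[OF grid_point_in_interval[OF less_imp_le[OF S] that]] k by auto
  then show "stays_on_grids S a b f" unfolding stays_on_grids_def by blast
qed

text \<open>The dyadic grids are nested, so the events decrease in \<open>n\<close>, and they increase in \<open>k\<close>.
  Therefore the probability of staying is a double limit of probabilities of boxes.\<close>

lemma stays_on_grids_limits:
  fixes Z :: "real \<Rightarrow> 'a \<Rightarrow> real" and a b :: real
  assumes "prob_space N" and S: "0 \<le> S" and Z: "\<forall>s\<in>{0..S}. Z s \<in> borel_measurable N"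
  defines "E \<equiv> \<lambda>k n. {\<omega> \<in> space N. \<forall>j<Suc (2 ^ n). Z (S * real j / 2 ^ n) \<omega> \<in> {a + 1 / real (Suc k)..b - 1 / real (Suc k)}}"
  shows "(\<lambda>k. measure N (\<Inter>n. E k n)) \<longlonglongrightarrow> measure N {\<omega> \<in> space N. stays_on_grids S a b (\<lambda>s. Z s \<omega>)}"
    and "\<And>k. (\<lambda>n. measure N (E k n)) \<longlonglongrightarrow> measure N (\<Inter>n. E k n)"
    and "{\<omega> \<in> space N. stays_on_grids S a b (\<lambda>s. Z s \<omega>)} \<in> sets N"
proof -
  interpret prob_space N by fact
  have sets: "E k n \<in> sets N" for k n
  proof -
    note [measurable] = Z[rule_format, OF grid_point_in_interval[OF S]]
    have *: "E k n = (\<Inter>j\<in>{..<Suc (2 ^ n)}. {\<omega> \<in> space N. Z (S * real j / 2 ^ n) \<omega> \<in> {a + 1 / real (Suc k)..b - 1 / real (Suc k)}})"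
      unfolding E_def by auto
    show ?thesis unfolding * by (rule sets.finite_INT) (auto intro!: measurable_sets_Collect)
  qed
  have eq: "{\<omega> \<in> space N. stays_on_grids S a b (\<lambda>s. Z s \<omega>)} = (\<Union>k. \<Inter>n. E k n)"
    unfolding E_def stays_on_grids_def by auto
  show "{\<omega> \<in> space N. stays_on_grids S a b (\<lambda>s. Z s \<omega>)} \<in> sets N"
    unfolding eq using sets by auto
  have dec: "decseq (E k)" for k
  proof (rule decseq_SucI, rule subsetI)
    fix n \<omega> assume \<omega>: "\<omega> \<in> E k (Suc n)"
    have "Z (S * real j / 2 ^ n) \<omega> \<in> {a + 1 / real (Suc k)..b - 1 / real (Suc k)}" if "j < Suc (2 ^ n)" for j
    proof -
      have "Z (S * real (2 * j) / 2 ^ Suc n) \<omega> \<in> {a + 1 / real (Suc k)..b - 1 / real (Suc k)}"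
        using \<omega> that unfolding E_def by (simp del: of_nat_mult)
      then show ?thesis by simp
    qed
    then show "\<omega> \<in> E k n" using \<omega> unfolding E_def by auto
  qed
  show "(\<lambda>n. measure N (E k n)) \<longlonglongrightarrow> measure N (\<Inter>n. E k n)" for k
    by (rule finite_Lim_measure_decseq) (use sets dec in auto)
  have "incseq (\<lambda>k. \<Inter>n. E k n)"
  proof (rule incseq_SucI, rule INT_anti_mono[OF order_refl])
    fix k n
    have "1 / real (Suc (Suc k)) \<le> 1 / real (Suc k)" by (simp add: frac_le)
    then have "{a + 1 / real (Suc k)..b - 1 / real (Suc k)} \<subseteq> {a + 1 / real (Suc (Suc k))..b - 1 / real (Suc (Suc k))}"
      by (intro atLeastatMost_subset_iff[THEN iffD2] disjI2) linarith
    then show "E k n \<subseteq> E (Suc k) n" unfolding E_def by blast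
  qed
  then show "(\<lambda>k. measure N (\<Inter>n. E k n)) \<longlonglongrightarrow> measure N {\<omega> \<in> space N. stays_on_grids S a b (\<lambda>s. Z s \<omega>)}"
    unfolding eq using sets by (intro finite_Lim_measure_incseq) auto
qed

lemma stays_on_grids_prob_cong:
  fixes Z :: "real \<Rightarrow> 'a \<Rightarrow> real" and Z' :: "real \<Rightarrow> 'b \<Rightarrow> real"
  assumes N: "prob_space N" and S: "0 \<le> S" and Z: "\<forall>s\<in>{0..S}. Z s \<in> borel_measurable N"
    and N': "prob_space N'" and Z': "\<forall>s\<in>{0..S}. Z' s \<in> borel_measurable N'"
    and box: "\<And>n c d. measure N {\<omega> \<in> space N. \<forall>j<Suc (2 ^ n). Z (S * real j / 2 ^ n) \<omega> \<in> {c..d}}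
       = measure N' {\<omega> \<in> space N'. \<forall>j<Suc (2 ^ n). Z' (S * real j / 2 ^ n) \<omega> \<in> {c..d}}"
  shows "measure N {\<omega> \<in> space N. stays_on_grids S a b (\<lambda>s. Z s \<omega>)}
       = measure N' {\<omega> \<in> space N'. stays_on_grids S a b (\<lambda>s. Z' s \<omega>)}"
proof -
  have "measure N (\<Inter>n. {\<omega> \<in> space N. \<forall>j<Suc (2 ^ n). Z (S * real j / 2 ^ n) \<omega> \<in> {a + 1 / real (Suc k)..b - 1 / real (Suc k)}})
     = measure N' (\<Inter>n. {\<omega> \<in> space N'. \<forall>j<Suc (2 ^ n). Z' (S * real j / 2 ^ n) \<omega> \<in> {a + 1 / real (Suc k)..b - 1 / real (Suc k)}})" for k
    using stays_on_grids_limits(2)[OF N S Z, where a = a and b = b and k = k] stays_on_grids_limits(2)[OF N' S Z', where a = a and b = b and k = k]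
    unfolding box by (rule LIMSEQ_unique)
  then have "(\<lambda>k. measure N (\<Inter>n. {\<omega> \<in> space N. \<forall>j<Suc (2 ^ n). Z (S * real j / 2 ^ n) \<omega> \<in> {a + 1 / real (Suc k)..b - 1 / real (Suc k)}}))
     \<longlonglongrightarrow> measure N' {\<omega> \<in> space N'. stays_on_grids S a b (\<lambda>s. Z' s \<omega>)}"
    using stays_on_grids_limits(1)[OF N' S Z', where a = a and b = b] by (simp only:)
  with stays_on_grids_limits(1)[OF N S Z, where a = a and b = b] show ?thesis
    by (rule LIMSEQ_unique)
qed

section \<open>The exit time representation\<close>

text \<open>The infimum over exit times is a minimum because the path is continuous and the interval is
  open, so a non-strict bound on it is witnessed by an actual exit.\<close>

lemma exit_time_le_iff:
  assumes cont: "continuous_on {0..} (\<lambda>s. w s \<omega>)" and S: "0 \<le> S"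
  shows "exit_time w a b \<omega> \<le> ereal S \<longleftrightarrow> (\<exists>s\<in>{0..S}. w s \<omega> \<notin> {a<..<b})"
proof
  assume "\<exists>s\<in>{0..S}. w s \<omega> \<notin> {a<..<b}"
  then obtain s where s: "0 \<le> s" "s \<le> S" "w s \<omega> \<notin> {a<..<b}" by auto
  then have "exit_time w a b \<omega> \<le> ereal s" unfolding exit_time_def by (intro Inf_lower) auto
  also have "\<dots> \<le> ereal S" using s by simp
  finally show "exit_time w a b \<omega> \<le> ereal S" .
next
  assume le: "exit_time w a b \<omega> \<le> ereal S"
  \<comment> \<open>If the path stayed in the open interval up to time \<open>S\<close>, it would stay there a bit longer.\<close>
  show "\<exists>s\<in>{0..S}. w s \<omega> \<notin> {a<..<b}"
  proof (rule ccontr)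
    assume "\<not> ?thesis"
    then have stay: "w s \<omega> \<in> {a<..<b}" if "0 \<le> s" "s \<le> S" for s using that by auto
    have "\<exists>e>0. \<forall>s\<in>{0..}. dist s S < e \<longrightarrow> dist (w s \<omega>) (w S \<omega>) < min (w S \<omega> - a) (b - w S \<omega>)"
      using S stay[of S] by (intro cont[unfolded continuous_on_iff, rule_format, of S]) auto
    then obtain e where e: "0 < e"
      and near: "\<And>s. 0 \<le> s \<Longrightarrow> dist s S < e \<Longrightarrow> dist (w s \<omega>) (w S \<omega>) < min (w S \<omega> - a) (b - w S \<omega>)"
      by auto
    have "w s \<omega> \<in> {a<..<b}" if "0 \<le> s" "s < S + e" for s
    proof (cases "s \<le> S")
      case False
      then have "dist (w s \<omega>) (w S \<omega>) < min (w S \<omega> - a) (b - w S \<omega>)"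
        using that by (intro near) (auto simp: dist_real_def)
      then show ?thesis by (auto simp: dist_real_def)
    qed (use stay that in auto)
    then have "ereal (S + e) \<le> exit_time w a b \<omega>"
      unfolding exit_time_def by (intro Inf_greatest) (force simp: not_less)
    from this le have "ereal (S + e) \<le> ereal S" by (rule order_trans)
    with e show False by simp
  qed
qed

text \<open>The indicator appears because a start outside the interval counts as an immediate exit.\<close>

lemma brownian_stay_probability:
  assumes w: "standard_brownian_motion M w" and S: "0 < S"
  shows "measure M {\<omega> \<in> space M. stays_on_grids S a b (\<lambda>s. y + w s \<omega>)}
     = indicator {a<..<b} y * (1 - exit_time_cdf M w (a - y) (b - y) S)"
proof -
  interpret prob_space M using w unfolding standard_brownian_motion_def by blast
  have cont: "continuous_on {0..} (\<lambda>s. w s \<omega>)" and start: "w 0 \<omega> = 0" if "\<omega> \<in> space M" for \<omega>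
    using w that unfolding standard_brownian_motion_def by auto
  have meas: "\<forall>s\<in>{0..S}. (\<lambda>\<omega>. y + w s \<omega>) \<in> borel_measurable M"
    using brownian_measurable[OF w] by auto
  have iff: "stays_on_grids S a b (\<lambda>s. y + w s \<omega>) \<longleftrightarrow> (\<forall>s\<in>{0..S}. y + w s \<omega> \<in> {a<..<b})" if "\<omega> \<in> space M" for \<omega>
    using cont[OF that] S
    by (intro stays_on_grids_iff continuous_intros) (auto elim: continuous_on_subset)
  show ?thesis
  proof (cases "y \<in> {a<..<b}")
    case True
    have "{\<omega> \<in> space M. exit_time w (a - y) (b - y) \<omega> \<le> ereal S}
        = space M - {\<omega> \<in> space M. stays_on_grids S a b (\<lambda>s. y + w s \<omega>)}"
    proof -
      have "exit_time w (a - y) (b - y) \<omega> \<le> ereal S \<longleftrightarrow> \<not> stays_on_grids S a b (\<lambda>s. y + w s \<omega>)" if "\<omega> \<in> space M" for \<omega>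
        unfolding iff[OF that] exit_time_le_iff[where w = w, OF cont[OF that] less_imp_le[OF S]]
        by (auto simp: less_diff_eq diff_less_eq add.commute)
      then show ?thesis by auto
    qed
    then show ?thesis
      using True stays_on_grids_limits(3)[OF prob_space_axioms less_imp_le[OF S] meas]
      unfolding exit_time_cdf_def by (simp add: prob_compl)
  next
    case False
    have "\<not> stays_on_grids S a b (\<lambda>s. y + w s \<omega>)" if "\<omega> \<in> space M" for \<omega>
      unfolding iff[OF that] using False start[OF that] S by (auto intro!: bexI[of _ 0])
    then have never: "{\<omega> \<in> space M. stays_on_grids S a b (\<lambda>s. y + w s \<omega>)} = {}" by blast
    show ?thesis unfolding never using False by simp
  qed
qed

text \<open>Fubini's theorem: conditionally on the start \<open>y\<close>, the probability is that of the Brownian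
  motion not leaving the interval shifted by \<open>- y\<close>.\<close>

lemma normal_start_stay_probability:
  assumes w: "standard_brownian_motion M w" and S: "0 < S" and v: "0 < v" and ab: "a \<le> b"
  shows "measure (density lborel (normal_density 0 (sqrt v)) \<Otimes>\<^sub>M M)
        {z \<in> space (density lborel (normal_density 0 (sqrt v)) \<Otimes>\<^sub>M M). stays_on_grids S a b (\<lambda>s. fst z + w s (snd z))}
     = (LBINT y=ereal a..ereal b. (1 - exit_time_cdf M w (a - y) (b - y) S) * normal_density 0 (sqrt v) y)"
proof -
  define G where "G = density lborel (normal_density 0 (sqrt v))"
  interpret M: prob_space M using w unfolding standard_brownian_motion_def by blast
  interpret G: prob_space G unfolding G_def using v by (intro prob_space_normal_density) simp
  interpret GM: pair_prob_space G M ..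
  have [measurable_cong]: "sets G = sets borel" unfolding G_def by simp
  have sG: "space G = UNIV" unfolding G_def by simp
  define F where "F = {z \<in> space (G \<Otimes>\<^sub>M M). stays_on_grids S a b (\<lambda>s. fst z + w s (snd z))}"
  have meas: "\<forall>s\<in>{0..S}. (\<lambda>z. fst z + w s (snd z)) \<in> borel_measurable (G \<Otimes>\<^sub>M M)"
  proof
    fix s assume "s \<in> {0..S}"
    then have [measurable]: "w s \<in> borel_measurable M" by (intro brownian_measurable[OF w]) simp
    show "(\<lambda>z. fst z + w s (snd z)) \<in> borel_measurable (G \<Otimes>\<^sub>M M)" by measurable
  qed
  have F[measurable]: "F \<in> sets (G \<Otimes>\<^sub>M M)"
    unfolding F_def by (rule stays_on_grids_limits(3)[OF GM.P.prob_space_axioms less_imp_le[OF S] meas])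
  have int: "integrable (G \<Otimes>\<^sub>M M) (indicator F :: _ \<Rightarrow> real)"
    using F by (intro integrable_real_indicator) (auto simp: less_top[symmetric])
  have slice: "(\<integral>\<omega>. indicator F (y, \<omega>) \<partial>M) = indicator {a<..<b} y * (1 - exit_time_cdf M w (a - y) (b - y) S)" for y
  proof -
    have "(\<integral>\<omega>. indicator F (y, \<omega>) \<partial>M) = (\<integral>\<omega>. indicat_real {\<omega> \<in> space M. stays_on_grids S a b (\<lambda>s. y + w s \<omega>)} \<omega> \<partial>M)"
      by (intro Bochner_Integration.integral_cong) (auto simp: F_def indicator_def space_pair_measure sG)
    also have "\<dots> = measure M {\<omega> \<in> space M. stays_on_grids S a b (\<lambda>s. y + w s \<omega>)}"
      by (simp add: Int_absorb2)
    finally show ?thesis unfolding brownian_stay_probability[OF w S] .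
  qed
  have "measure (G \<Otimes>\<^sub>M M) F = (\<integral>z. indicator F z \<partial>(G \<Otimes>\<^sub>M M))"
    using F by (simp add: sets.Int_space_eq2)
  also have "\<dots> = (\<integral>y. (\<integral>\<omega>. indicator F (y, \<omega>) \<partial>M) \<partial>G)"
    by (rule GM.integral_fst'[OF int, symmetric])
  also have "\<dots> = (\<integral>y. normal_density 0 (sqrt v) y *\<^sub>R (\<integral>\<omega>. indicator F (y, \<omega>) \<partial>M) \<partial>lborel)"
  proof -
    have "(\<lambda>y. \<integral>\<omega>. indicat_real F (y, \<omega>) \<partial>M) \<in> borel_measurable G"
      by (rule M.borel_measurable_lebesgue_integral) (use F in simp)
    then show ?thesis
      unfolding G_def by (intro integral_density) auto
  qed
  also have "\<dots> = (LBINT y=ereal a..ereal b. (1 - exit_time_cdf M w (a - y) (b - y) S) * normal_density 0 (sqrt v) y)"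
    unfolding slice interval_lebesgue_integral_def set_lebesgue_integral_def using ab
    by (simp add: mult_ac)
  finally show ?thesis unfolding F_def G_def .
qed

text \<open>The rescaled solution and the Brownian motion with a random start live on different
  probability spaces, but their linear combinations on a grid have equal characteristic
  functions, hence all boxes have equal probabilities, and these determine the probability of
  staying in the interval.\<close>

lemma rescaled_solution_stay_probability:
  assumes P: "white_noise_space P" and u: "\<And>c. 0 < c \<Longrightarrow> random_field_solution P c (u c)"
    and w: "standard_brownian_motion M w"
    and t: "0 < t" and v: "0 < v" and S: "0 < S" and ab: "a \<le> b"
  shows "{\<omega> \<in> space P. stays_on_grids S a b (\<lambda>s. 2 / t * u (1 / (v + s)) x t \<omega>)} \<in> sets P" (is ?sets)
    and "measure P {\<omega> \<in> space P. stays_on_grids S a b (\<lambda>s. 2 / t * u (1 / (v + s)) x t \<omega>)}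
     = (LBINT y=ereal a..ereal b. (1 - exit_time_cdf M w (a - y) (b - y) S) * normal_density 0 (sqrt v) y)"
proof -
  define Q where "Q = density lborel (normal_density 0 (sqrt v)) \<Otimes>\<^sub>M M"
  interpret P: prob_space P by (rule prob_space_white_noise[OF P])
  have probQ: "prob_space Q"
  proof -
    interpret M: prob_space M using w unfolding standard_brownian_motion_def by blast
    interpret G: prob_space "density lborel (normal_density 0 (sqrt v))"
      using v by (intro prob_space_normal_density) simp
    interpret GM: pair_prob_space "density lborel (normal_density 0 (sqrt v))" M ..
    show ?thesis unfolding Q_def by (rule GM.P.prob_space_axioms)
  qed
  have solution_measurable: "u c x t \<in> borel_measurable P" if "0 < c" for c
    using u[OF that] t unfolding random_field_solution_def white_noise_pairing_def by blast
  have measP: "\<forall>s\<in>{0..S}. (\<lambda>\<omega>. 2 / t * u (1 / (v + s)) x t \<omega>) \<in> borel_measurable P"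
  proof
    fix s assume "s \<in> {0..S}"
    then have [measurable]: "u (1 / (v + s)) x t \<in> borel_measurable P"
      using v by (intro solution_measurable) auto
    show "(\<lambda>\<omega>. 2 / t * u (1 / (v + s)) x t \<omega>) \<in> borel_measurable P" by measurable
  qed
  have measQ: "\<forall>s\<in>{0..S}. (\<lambda>z. fst z + w s (snd z)) \<in> borel_measurable Q"
  proof
    fix s assume "s \<in> {0..S}"
    then have [measurable]: "w s \<in> borel_measurable M" by (intro brownian_measurable[OF w]) simp
    show "(\<lambda>z. fst z + w s (snd z)) \<in> borel_measurable Q" unfolding Q_def by measurable
  qed
  show ?sets by (rule stays_on_grids_limits(3)[OF P.prob_space_axioms less_imp_le[OF S] measP])
  have "measure P {\<omega> \<in> space P. stays_on_grids S a b (\<lambda>s. 2 / t * u (1 / (v + s)) x t \<omega>)}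
      = measure Q {z \<in> space Q. stays_on_grids S a b (\<lambda>s. fst z + w s (snd z))}"
  proof (rule stays_on_grids_prob_cong[OF P.prob_space_axioms less_imp_le[OF S] measP probQ measQ])
    fix n c d
    define T where "T j = S * real j / 2 ^ n" for j
    have T: "incseq T" "T 0 = 0"
      unfolding T_def incseq_def using S by (auto intro!: divide_right_mono mult_left_mono)
    have vT: "0 < v + T j" for j using v S unfolding T_def by (simp add: add_pos_nonneg)
    have "measure P {\<omega> \<in> space P. \<forall>j<Suc (2 ^ n). 2 / t * u (1 / (v + T j)) x t \<omega> \<in> {c..d}}
        = measure Q {z \<in> space Q. \<forall>j<Suc (2 ^ n). fst z + w (T j) (snd z) \<in> {c..d}}"
    proof (rule box_probabilities_determined_by_char[OF P.prob_space_axioms probQ])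
      fix j assume "j < Suc (2 ^ n)"
      then have "T j \<in> {0..S}" unfolding T_def by (rule grid_point_in_interval[OF less_imp_le[OF S]])
      then show "(\<lambda>\<omega>. 2 / t * u (1 / (v + T j)) x t \<omega>) \<in> borel_measurable P"
        "(\<lambda>z. fst z + w (T j) (snd z)) \<in> borel_measurable Q"
        using measP measQ by auto
    next
      fix \<theta>
      show "(\<integral>\<omega>. iexp (\<Sum>j<Suc (2 ^ n). \<theta> j * (2 / t * u (1 / (v + T j)) x t \<omega>)) \<partial>P)
          = (\<integral>z. iexp (\<Sum>j<Suc (2 ^ n). \<theta> j * (fst z + w (T j) (snd z))) \<partial>Q)"
        unfolding Q_def char_shifted_start[OF w T v]
        by (rule char_rescaled_solution[OF P u t vT]) auto
    qed simp
    then show "measure P {\<omega> \<in> space P. \<forall>j<Suc (2 ^ n). 2 / t * u (1 / (v + S * real j / 2 ^ n)) x t \<omega> \<in> {c..d}}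
        = measure Q {z \<in> space Q. \<forall>j<Suc (2 ^ n). fst z + w (S * real j / 2 ^ n) (snd z) \<in> {c..d}}"
      unfolding T_def .
  qed
  then show "measure P {\<omega> \<in> space P. stays_on_grids S a b (\<lambda>s. 2 / t * u (1 / (v + s)) x t \<omega>)}
     = (LBINT y=ereal a..ereal b. (1 - exit_time_cdf M w (a - y) (b - y) S) * normal_density 0 (sqrt v) y)"
    unfolding Q_def normal_start_stay_probability[OF w S v ab] .
qed

theorem mainTheorem5:
  fixes P :: "((real \<times> real \<Rightarrow> real) \<Rightarrow> real) measure"
    and u :: "real \<Rightarrow> real \<Rightarrow> real \<Rightarrow> ((real \<times> real \<Rightarrow> real) \<Rightarrow> real) \<Rightarrow> real"
    and M :: "'b measure"
    and w :: "real \<Rightarrow> 'b \<Rightarrow> real"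
    and x t cl cu bl bu rl ru :: real
    and g :: "real \<Rightarrow> real"
    and X :: "((real \<times> real \<Rightarrow> real) \<Rightarrow> real) \<Rightarrow> real set"
  assumes white_noise: "white_noise_space P"
    and solution: "\<And>c. 0 < c \<Longrightarrow> random_field_solution P c (u c)"
    and continuous_version: "AE \<omega> in P. continuous_on {0<..} (\<lambda>c. u c x t \<omega>)"
    and brownian: "standard_brownian_motion M w"
    and "0 < t" and "0 < cl" and "cl < cu" and "bl < bu"
    and X_def: "\<And>\<omega>. X \<omega> = (\<lambda>c. u c x t \<omega>) ` {cl..cu}"
    and rl_def: "rl = 1 / cu" and ru_def: "ru = 1 / cl"
    and g_def: "\<And>y. g y = 1 / sqrt (2 * pi * rl) * exp (- y\<^sup>2 / (2 * rl))"
  shows "{\<omega> \<in> space P. X \<omega> \<subseteq> {bl<..<bu}} \<in> sets P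
    \<and> lower_probability P X {bl<..<bu} =
        (LBINT y = ereal (2 / t * bl)..ereal (2 / t * bu).
           (1 - exit_time_cdf M w (2 / t * bl - y) (2 / t * bu - y) (ru - rl)) * g y)"
proof -
  define S where "S = ru - rl"
  define a where "a = 2 / t * bl"
  define b where "b = 2 / t * bu"
  have pos: "0 < cu" "0 < rl" "0 < S" and ab: "a \<le> b"
    using \<open>0 < t\<close> \<open>0 < cl\<close> \<open>cl < cu\<close> \<open>bl < bu\<close>
    unfolding S_def rl_def ru_def a_def b_def by (auto simp: frac_less2 divide_le_cancel)
  define E where "E = {\<omega> \<in> space P. stays_on_grids S a b (\<lambda>s. 2 / t * u (1 / (rl + s)) x t \<omega>)}"
  note stay = rescaled_solution_stay_probability[OF white_noise solution brownian \<open>0 < t\<close> pos(2,3) ab, of x, folded E_def]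
  have speeds: "(\<lambda>s. 1 / (rl + s)) ` {0..S} = {cl..cu}"
  proof (intro set_eqI iffI)
    fix c assume "c \<in> {cl..cu}"
    then have c: "cl \<le> c" "c \<le> cu" "0 < c" using \<open>0 < cl\<close> by auto
    have "1 / c \<le> ru" "rl \<le> 1 / c" unfolding rl_def ru_def using c \<open>0 < cl\<close> by (auto intro: frac_le)
    then show "c \<in> (\<lambda>s. 1 / (rl + s)) ` {0..S}"
      unfolding S_def using c by (intro image_eqI[of _ _ "1 / c - rl"]) auto
  next
    fix c assume "c \<in> (\<lambda>s. 1 / (rl + s)) ` {0..S}"
    then obtain s where s: "0 \<le> s" "rl + s \<le> ru" "c = 1 / (rl + s)" unfolding S_def by auto
    have "1 / ru \<le> c" "c \<le> 1 / rl"
      unfolding s(3) using s pos by (auto intro!: divide_left_mono mult_pos_pos)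
    then show "c \<in> {cl..cu}" unfolding rl_def ru_def by simp
  qed
  have scale: "y \<in> {bl<..<bu} \<longleftrightarrow> 2 / t * y \<in> {a<..<b}" for y
    unfolding a_def b_def using \<open>0 < t\<close> by (auto simp: divide_less_cancel)
  have event: "X \<omega> \<subseteq> {bl<..<bu} \<longleftrightarrow> stays_on_grids S a b (\<lambda>s. 2 / t * u (1 / (rl + s)) x t \<omega>)"
    if cont: "continuous_on {0<..} (\<lambda>c. u c x t \<omega>)" for \<omega>
  proof -
    have "continuous_on {0..S} (\<lambda>s. u (1 / (rl + s)) x t \<omega>)"
      using pos by (intro continuous_on_compose2[OF cont] continuous_intros) auto
    then have "stays_on_grids S a b (\<lambda>s. 2 / t * u (1 / (rl + s)) x t \<omega>)
        \<longleftrightarrow> (\<forall>s\<in>{0..S}. u (1 / (rl + s)) x t \<omega> \<in> {bl<..<bu})"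
      unfolding scale using pos by (intro stays_on_grids_iff continuous_intros)
    then show ?thesis by (simp only: X_def speeds[symmetric] image_image image_subset_iff)
  qed
  \<comment> \<open>Off a null set the path is continuous, so the two events differ by a subset of a null set,
    which is measurable since \<open>P\<close> is complete.\<close>
  have ae: "AE \<omega> in P. \<omega> \<in> E \<longleftrightarrow> \<omega> \<in> {\<omega> \<in> space P. X \<omega> \<subseteq> {bl<..<bu}}"
    using continuous_version by eventually_elim (auto simp: E_def event)
  obtain P0 where "P = completion P0"
    using white_noise unfolding white_noise_space_def by blast
  then interpret complete_measure P by (simp add: completion.complete_measure_axioms)
  have sets: "{\<omega> \<in> space P. X \<omega> \<subseteq> {bl<..<bu}} \<in> sets P"
    using ae stay(1) by (rule in_sets_AE) auto
  have "lower_probability P X {bl<..<bu} = measure P E"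
    unfolding lower_probability_def using ae by (intro measure_eq_AE sets stay(1)) auto
  moreover have "g = normal_density 0 (sqrt rl)"
    using pos by (simp add: fun_eq_iff g_def normal_density_def)
  ultimately show ?thesis
    using sets stay(2) unfolding a_def b_def S_def by simp
qed

end
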